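(* Let $g\colon\mathbb{R}^3\to\mathbb{R}$ and $\varphi\colon\mathbb{R}^2\to\mathbb{R}$ be locally Lipschitz, and let $I\subseteq\mathbb{R}$ be an open interval. Assume that $\Phi(u)=g(u,0,\varphi(u,0))$ changes sign at the (pairwise distinct) isolated zeros $p_1,\ldots,p_n\in I$. Then, for sufficiently high frequency of the perturbing term $f$ and sufficiently small $\lambda>0$, the equation $$\ddot x(t)=g\Big(x(t),\dot x(t),\int_{-\infty}^t\gamma_a^b(t-s)\,\varphi(x(s),\dot x(s))\,ds\Big)+\lambda f\big(t,x(t),\dot x(t)\big)$$ has at least $n$ solutions of period $T$ whose images are pairwise disjoint. That is: there exists $T_0>0$ such that, for every $T\in(0,T_0)$ and every continuous $f\colon\mathbb{R}^3\to\mathbb{R}$ that is $T$-periodic in its first variable, there exists $\lambda_*>0$ such that for every $\lambda\in(0,\lambda_* )$ the equation has at least $n$ $T$-periodic solutions with pairwise disjoint images.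
   Context: Let $a>0$ and $b\in\mathbb{N}\setminus\{0\}$. The gamma probability density $\gamma_a^b$ is $$\gamma_a^b(s)=\frac{a^b s^{b-1}e^{-as}}{(b-1)!}\ \text{ for } s\ge 0,\qquad \gamma_a^b(s)=0\ \text{ for } s<0.$$ The frequency of $f$ is $1/T$. A $T$-periodic solution of the equation is a $C^2$ function $x\colon\mathbb{R}\to\mathbb{R}$ of period $T$ satisfying it identically on $\mathbb{R}$. $\Phi$ changes sign at an isolated zero $p$ if $\Phi$ has opposite (strict) signs immediately to the left and to the right of $p$. *)

theory Defs
  imports "HOL-Probability.Probability"
begin

definition locally_lipschitz :: "('a::metric_space \<Rightarrow> 'b::metric_space) \<Rightarrow> bool" where
  "locally_lipschitz h \<longleftrightarrow> (\<forall>x. \<exists>\<epsilon>>0. \<exists>L. L-lipschitz_on (ball x \<epsilon>) h)"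

text \<open>The gamma density with rate \<open>a\<close> and shape \<open>b\<close> is the library's Erlang density, whose
  first argument is the shape minus one.\<close>

definition gamma_density :: "real \<Rightarrow> nat \<Rightarrow> real \<Rightarrow> real" where
  "gamma_density a b = erlang_density (b - 1) a"

lemma gamma_density_eq:
  assumes "b \<ge> 1"
  shows "gamma_density a b s =
    (if s < 0 then 0 else a ^ b * s ^ (b - 1) * exp (- a * s) / fact (b - 1))"
  using assms by (simp add: gamma_density_def erlang_density_def)

definition changes_sign_at_isolated_zero :: "(real \<Rightarrow> real) \<Rightarrow> real \<Rightarrow> bool" where
  "changes_sign_at_isolated_zero F p \<longleftrightarrow>
     F p = 0 \<and> (\<forall>\<^sub>F u in at p. F u \<noteq> 0) \<and>
     ((\<forall>\<^sub>F u in at_left p. F u < 0) \<and> (\<forall>\<^sub>F u in at_right p. F u > 0) \<or>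
      (\<forall>\<^sub>F u in at_left p. F u > 0) \<and> (\<forall>\<^sub>F u in at_right p. F u < 0))"

text \<open>The functions \<open>v\<close> and \<open>w\<close> are the first and second derivatives of \<open>x\<close>. As \<open>x\<close> and \<open>v\<close> are
  continuous and periodic, hence bounded, the delay integral converges absolutely whenever
  \<open>\<phi>\<close> is continuous, \<open>a > 0\<close> and \<open>b \<ge> 1\<close>. \<open>T\<close> need not be the minimal period.\<close>

definition periodic_solution ::
  "real \<Rightarrow> nat \<Rightarrow> (real \<times> real \<times> real \<Rightarrow> real) \<Rightarrow> (real \<times> real \<Rightarrow> real) \<Rightarrow>
   real \<Rightarrow> (real \<times> real \<times> real \<Rightarrow> real) \<Rightarrow> real \<Rightarrow> (real \<Rightarrow> real) \<Rightarrow> bool" where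
  "periodic_solution a b g \<phi> l f T x \<longleftrightarrow>
     (\<forall>t. x (t + T) = x t) \<and>
     (\<exists>v w. (\<forall>t. (x has_real_derivative v t) (at t)) \<and>
            (\<forall>t. (v has_real_derivative w t) (at t)) \<and>
            continuous_on UNIV w \<and>
            (\<forall>t. w t =
               g (x t, v t, LINT s:{..t}|lborel. gamma_density a b (t - s) * \<phi> (x s, v s))
               + l * f (t, x t, v t)))"

end

theory Submission
  imports Defs "HOL-Complex_Analysis.Great_Picard"
begin

text \<open>
  Write the equation as \<open>x'' = N(x)\<close> and let \<open>w\<close> be the unknown second derivative up to a constant and
  an orientation sign \<open>\<sigma>\<close>. A \<open>T\<close>-periodic \<open>w\<close> with \<open>\<bar>w\<bar> \<le> M\<close> has mean-zero part \<open>y''\<close> with \<open>y\<close>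
  periodic, \<open>y(0) = 0\<close>, \<open>\<bar>y\<bar> = O(T\<^sup>2 M)\<close> and \<open>\<bar>y'\<bar> = O(T M)\<close>, so for small \<open>T\<close> the function
  \<open>x = p + c(w) + \<sigma>y\<close> is almost constant; here \<open>c(w)\<close> is the mean of \<open>w\<close> truncated to \<open>[-\<epsilon>, \<epsilon>]\<close>.
  Schauder's theorem gives a fixed point of \<open>w \<mapsto> \<sigma>N(x) + c(w)\<close>. With \<open>\<sigma>\<close> chosen such that
  \<open>\<sigma>\<Phi>\<close> is positive at \<open>p - \<epsilon>\<close> and negative at \<open>p + \<epsilon>\<close>, the truncation is inactive at the fixed point:
  otherwise \<open>x\<close> would be close to \<open>p \<plusminus> \<epsilon>\<close>, and the sign of \<open>N(x)\<close> would pull the mean of \<open>w\<close> back.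
  So \<open>c(w)\<close> is the mean of \<open>w\<close>, and \<open>x'' = \<sigma>(w - c(w)) = N(x)\<close>. The solution stays within
  \<open>2\<epsilon>\<close> of \<open>p\<close>, which separates the images for distinct zeros.

  As \<open>f\<close> is merely continuous, Schauder's theorem cannot be replaced by a contraction argument. It is
  obtained from Kuhn's combinatorial lemma on cubes of arbitrary dimension, by interpolating with a
  periodic partition of unity and passing to the limit with the Arzela-Ascoli theorem.
\<close>

section \<open>Schauder's theorem for periodic functions\<close>

text \<open>Kuhn's combinatorial lemma on a grid of mesh at most \<open>d\<close> in the cube of
  side \<open>2 * M\<close>. For each coordinate, one small cell has a vertex where \<open>F\<close>
  does not lower that coordinate and a vertex where \<open>F\<close> does not raise it, so at the
  corner of the cell the coordinate is nearly fixed.\<close>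

lemma cube_approx_fixpoint:
  fixes F :: "(nat \<Rightarrow> real) \<Rightarrow> nat \<Rightarrow> real" and M d e :: real
  assumes M: "M > 0" and d: "d > 0"
    and bd: "\<And>c i. (\<forall>j<n. \<bar>c j\<bar> \<le> M) \<Longrightarrow> i < n \<Longrightarrow> \<bar>F c i\<bar> \<le> M"
    and uc: "\<And>c c' i. \<lbrakk>\<forall>j<n. \<bar>c j\<bar> \<le> M; \<forall>j<n. \<bar>c' j\<bar> \<le> M; \<forall>j<n. \<bar>c j - c' j\<bar> \<le> d; i < n\<rbrakk>
      \<Longrightarrow> \<bar>F c i - F c' i\<bar> \<le> e"
  obtains c where "\<forall>j<n. \<bar>c j\<bar> \<le> M" "\<forall>i<n. \<bar>F c i - c i\<bar> \<le> e + d"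
proof -
  obtain N :: nat where N: "2 * M / d < real N" using reals_Archimedean2 by blast
  have N0: "N > 0" using N M d by (metis divide_pos_pos gr0I less_asym mult_pos_pos of_nat_0 zero_less_numeral)
  have Nd: "2 * M / real N \<le> d" using N N0 d by (simp add: field_simps)
  define C where "C x j = 2 * M * real (x j) / real N - M" for x :: "nat \<Rightarrow> nat" and j
  have C: "\<bar>C x j\<bar> \<le> M" if "x j \<le> N" for x j
  proof -
    have "2 * M * real (x j) \<le> 2 * M * real N" using that M by (intro mult_left_mono) auto
    then have "2 * M * real (x j) / real N \<le> 2 * M" using N0 by (simp add: field_simps)
    moreover have "0 \<le> 2 * M * real (x j) / real N" using M by simp
    ultimately show ?thesis unfolding C_def by linarith
  qed
  \<comment> \<open>Off the two faces, label 1 means that \<open>F\<close> lowers coordinate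
    \<open>i\<close>. The faces \<open>x i = 0\<close> and \<open>x i = N\<close> carry the labels
    prescribed by Kuhn's lemma; these agree with the direction of \<open>F\<close>, up to equality,
    because its values stay in the cube.\<close>
  define lab where "lab x i = (if x i = N \<or> x i \<noteq> 0 \<and> F (C x) i < C x i then 1 else 0::nat)" for x i
  obtain q where q: "\<forall>i<n. q i < N"
    and rs: "\<forall>i<n. \<exists>r s. (\<forall>j<n. q j \<le> r j \<and> r j \<le> q j + 1) \<and> (\<forall>j<n. q j \<le> s j \<and> s j \<le> q j + 1)
      \<and> lab r i \<noteq> lab s i"
    by (rule kuhn_lemma[OF N0, of n lab]) (use N0 in \<open>auto simp: lab_def\<close>)
  have lab0: "C x i \<le> F (C x) i" if "lab x i = 0" "\<forall>j<n. x j \<le> N" "i < n" for x i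
  proof (cases "x i = 0")
    case True
    have "\<bar>F (C x) i\<bar> \<le> M" using that C by (intro bd) auto
    then show ?thesis using True by (simp add: C_def)
  next
    case False
    then show ?thesis using that by (auto simp: lab_def split: if_splits)
  qed
  have lab1: "F (C x) i \<le> C x i" if "lab x i \<noteq> 0" "\<forall>j<n. x j \<le> N" "i < n" for x i
  proof (cases "x i = N")
    case True
    have "\<bar>F (C x) i\<bar> \<le> M" using that C by (intro bd) auto
    then show ?thesis using True N0 by (simp add: C_def)
  next
    case False
    then show ?thesis using that by (auto simp: lab_def split: if_splits)
  qed
  have near: "\<bar>C x j - C q j\<bar> \<le> d" if "q j \<le> x j" "x j \<le> q j + 1" for x j
  proof -
    have "C x j - C q j = (2 * M / real N) * (real (x j) - real (q j))"
      by (simp add: C_def diff_divide_distrib right_diff_distrib)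
    moreover have "0 \<le> (2 * M / real N) * (real (x j) - real (q j))"
      using M that by (intro mult_nonneg_nonneg) auto
    moreover have "(2 * M / real N) * (real (x j) - real (q j)) \<le> 2 * M / real N"
      using M that by (intro mult_left_le) auto
    ultimately have "\<bar>C x j - C q j\<bar> \<le> 2 * M / real N" by linarith
    then show ?thesis using Nd by linarith
  qed
  show thesis
  proof (rule that[of "C q"])
    show "\<forall>j<n. \<bar>C q j\<bar> \<le> M" using q C by (simp add: less_imp_le)
    show "\<forall>i<n. \<bar>F (C q) i - C q i\<bar> \<le> e + d"
    proof (intro allI impI)
      fix i assume i: "i < n"
      obtain r s where rs: "\<forall>j<n. q j \<le> r j \<and> r j \<le> q j + 1" "\<forall>j<n. q j \<le> s j \<and> s j \<le> q j + 1"
        "lab r i = 0" "lab s i \<noteq> 0"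
      proof -
        obtain r s where *: "\<forall>j<n. q j \<le> r j \<and> r j \<le> q j + 1" "\<forall>j<n. q j \<le> s j \<and> s j \<le> q j + 1"
          "lab r i \<noteq> lab s i"
          using rs i by blast
        show thesis
        proof (cases "lab r i = 0")
          case True
          then show ?thesis using that[of r s] * by simp
        next
          case False
          then have "lab s i = 0" using *(3) by (auto simp: lab_def split: if_splits)
          then show ?thesis using that[of s r] * False by simp
        qed
      qed
      have le: "\<forall>j<n. r j \<le> N" "\<forall>j<n. s j \<le> N" using rs q by (metis Suc_eq_plus1 Suc_leI le_trans)+
      \<comment> \<open>Opposite signs of the displacement at \<open>r\<close> and \<open>s\<close>;
        moving to the corner \<open>q\<close> costs at most \<open>e\<close> in \<open>F\<close> and
        \<open>d\<close> in the coordinate.\<close>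
      have "C r i \<le> F (C r) i" "F (C s) i \<le> C s i" using lab0 lab1 rs le i by auto
      moreover have "\<bar>C r i - C q i\<bar> \<le> d" "\<bar>C s i - C q i\<bar> \<le> d" using near rs i by auto
      moreover have "\<bar>F (C r) i - F (C q) i\<bar> \<le> e" "\<bar>F (C s) i - F (C q) i\<bar> \<le> e"
        using near rs i le q C by (auto intro!: uc simp: less_imp_le)
      ultimately show "\<bar>F (C q) i - C q i\<bar> \<le> e + d" by linarith
    qed
  qed
qed

section \<open>Periodic functions and periodic partitions of unity\<close>

lemma periodic_shift:
  fixes F :: "real \<Rightarrow> 'a" and T :: real
  assumes "\<forall>t. F (t + T) = F t"
  shows "F (t + of_int k * T) = F t"
proof (induction k rule: int_induct[where k = 0])
  case (step1 i)
  then show ?case using assms[rule_format, of "t + of_int i * T"] by (simp add: algebra_simps)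
next
  case (step2 i)
  then show ?case using assms[rule_format, of "t + of_int (i - 1) * T"] by (simp add: algebra_simps)
qed simp

lemma shift_into_period:
  fixes t T :: real
  assumes "T > 0"
  obtains k :: int where "0 \<le> t + of_int k * T" "t + of_int k * T \<le> T"
proof (rule that[of "- \<lfloor>t / T\<rfloor>"])
  have "of_int \<lfloor>t / T\<rfloor> * T \<le> t / T * T" "t / T * T \<le> (of_int \<lfloor>t / T\<rfloor> + 1) * T"
    using assms by (intro mult_right_mono; linarith)+
  then show "0 \<le> t + of_int (- \<lfloor>t / T\<rfloor>) * T" "t + of_int (- \<lfloor>t / T\<rfloor>) * T \<le> T"
    using assms by (simp_all add: field_simps)
qed

text \<open>Tent functions of the distance to the translated period lattices \<open>s j + Z\<close>,
  normalised by their sum. Measuring the distance to a whole lattice makes them periodic, and the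
  sum is positive because the nodes \<open>s j\<close> form a finite \<open>d\<close>-net of one
  period.\<close>

lemma periodic_partition_of_unity:
  fixes T d :: real
  assumes T: "T > 0" and d: "d > 0"
  shows "\<exists>(n :: nat) (s :: nat \<Rightarrow> real) (h :: nat \<Rightarrow> real \<Rightarrow> real).
    (\<forall>j<n. s j \<in> {0..T}) \<and> (\<forall>j. continuous_on UNIV (h j)) \<and> (\<forall>j t. h j (t + T) = h j t) \<and>
    (\<forall>j t. 0 \<le> h j t) \<and> (\<forall>t. (\<Sum>j<n. h j t) = 1) \<and>
    (\<forall>j t. 0 < h j t \<longrightarrow> (\<exists>k::int. \<bar>t + of_int k * T - s j\<bar> < d))"
proof -
  define Z where "Z = range (\<lambda>k::int. of_int k * T)"
  have Z0: "Z \<noteq> {}" by (simp add: Z_def)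
  have shiftZ: "infdist (x + T) Z = infdist x Z" for x
  proof -
    have "(\<lambda>z. dist (x + T) z) ` Z = (\<lambda>z. dist x z) ` Z"
    proof -
      \<comment> \<open>Translation by \<open>T\<close> permutes the lattice \<open>Z\<close>, which
        is seen by reindexing.\<close>
      have "bij (\<lambda>k::int. k + 1)" by (rule bij_plus_right)
      then have "Z = (\<lambda>k::int. of_int (k + 1) * T) ` UNIV"
        unfolding Z_def by (subst bij_is_surj[symmetric]) (auto simp: image_image)
      then have "(\<lambda>z. dist (x + T) z) ` Z = (\<lambda>k::int. dist (x + T) (of_int (k + 1) * T)) ` UNIV"
        by (simp add: image_image)
      also have "\<dots> = (\<lambda>z. dist x z) ` Z"
        by (simp add: Z_def image_image dist_real_def algebra_simps)
      finally show ?thesis .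
    qed
    then show ?thesis using Z0 by (simp add: infdist_def)
  qed
  have "compact {0..T}" by simp
  then obtain K where K: "finite K" "K \<subseteq> {0..T}" "{0..T} \<subseteq> (\<Union>x\<in>K. ball x d)"
    using compactE_image[of "{0..T}" "{0..T}" "\<lambda>x. ball x d"] d by (metis UN_I centre_in_ball open_ball subsetI)
  obtain n s where s: "bij_betw s {..<n::nat} K" using K(1)
    by (metis bij_betw_from_nat_into_finite lessThan_atLeast0)
  define m where "m j t = max 0 (d - infdist (t - s j) Z)" for j t
  have mcont: "continuous_on UNIV (m j)" for j
    unfolding m_def by (intro continuous_intros)
  have mper: "m j (t + T) = m j t" for j t
    using shiftZ[of "t - s j"] by (simp add: m_def algebra_simps)
  have m0: "0 \<le> m j t" for j t by (simp add: m_def)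
  have mpos: "0 < (\<Sum>j<n. m j t)" for t
  proof -
    obtain k :: int where k: "t + of_int k * T \<in> {0..T}" using shift_into_period[OF T, of t] by auto
    then obtain x where x: "x \<in> K" "dist x (t + of_int k * T) < d" using K(3) by (meson UN_E mem_ball subsetD)
    then obtain j where j: "j < n" "s j = x" using s unfolding bij_betw_def by (metis imageE lessThan_iff)
    have "infdist (t - s j) Z \<le> dist (t - s j) (of_int (- k) * T)"
      unfolding Z_def by (intro infdist_le) blast
    also have "\<dots> < d" using x j by (simp add: dist_real_def algebra_simps abs_minus_commute)
    finally have "0 < m j t" by (simp add: m_def)
    then show ?thesis using j m0 by (intro sum_pos2[of _ j]) auto
  qed
  define h where "h j t = m j t / (\<Sum>j<n. m j t)" for j t
  show ?thesis
  proof (intro exI[of _ n] exI[of _ s] exI[of _ h] conjI allI impI)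
    fix j t
    show "s j \<in> {0..T}" if "j < n" using that s K(2) unfolding bij_betw_def by blast
    show "continuous_on UNIV (h j)" unfolding h_def
      using mpos by (intro continuous_intros mcont) (metis less_irrefl)
    show "h j (t + T) = h j t" by (simp add: h_def mper)
    show "0 \<le> h j t" using m0 mpos[of t] by (simp add: h_def)
    show "(\<Sum>j<n. h j t) = 1" using mpos[of t] by (simp add: h_def flip: sum_divide_distrib)
    show "\<exists>k::int. \<bar>t + of_int k * T - s j\<bar> < d" if "0 < h j t"
    proof -
      have "m j t > 0" using that mpos[of t] by (simp add: h_def zero_less_divide_iff)
      then have "infdist (t - s j) Z < d" by (simp add: m_def)
      then obtain z where "z \<in> Z" "dist (t - s j) z < d"
        using Z0 by (auto simp: infdist_def cInf_less_iff)
      then obtain k :: int where "\<bar>t - s j - of_int k * T\<bar> < d" by (auto simp: Z_def dist_real_def)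
      then show ?thesis by (intro exI[of _ "- k"]) (simp add: algebra_simps)
    qed
  qed
qed

text \<open>The closed sup-norm ball on which Schauder's theorem is applied. Its elements are
  functions on the whole line, so that derivatives and delays act on them directly.\<close>

definition periodic_ball :: "real \<Rightarrow> real \<Rightarrow> (real \<Rightarrow> real) set" where
  "periodic_ball T M = {w. continuous_on UNIV w \<and> (\<forall>t. w (t + T) = w t) \<and> (\<forall>t. \<bar>w t\<bar> \<le> M)}"

text \<open>An interval is convex. Asking for closeness only where the weight is positive suits a
  partition of unity, in which only nearby nodes contribute at a given time.\<close>

lemma abs_convex_sum_diff_le:
  fixes h c :: "nat \<Rightarrow> real"
  assumes "\<And>j. j < n \<Longrightarrow> 0 \<le> h j" "(\<Sum>j<n. h j) = 1"
    and "\<And>j. j < n \<Longrightarrow> 0 < h j \<Longrightarrow> \<bar>c j - y\<bar> \<le> e"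
  shows "\<bar>(\<Sum>j<n. h j * c j) - y\<bar> \<le> e"
proof -
  have "(\<Sum>j<n. h j * c j) - y = (\<Sum>j<n. h j * (c j - y))"
    using assms(2) by (simp add: right_diff_distrib sum_subtractf flip: sum_distrib_right)
  also have "\<bar>\<dots>\<bar> \<le> (\<Sum>j<n. h j * e)"
  proof (rule order_trans[OF sum_abs sum_mono])
    fix j assume j: "j \<in> {..<n}"
    show "\<bar>h j * (c j - y)\<bar> \<le> h j * e"
    proof (cases "h j = 0")
      case False
      then show ?thesis using assms(1,3)[of j] j by (simp add: abs_mult mult_left_mono)
    qed simp
  qed
  also have "\<dots> = e" using assms(2) by (simp flip: sum_distrib_right)
  finally show ?thesis .
qed

text \<open>Interpolating coefficients by a partition of unity embeds a finite-dimensional cube into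
  the ball without increasing distances, and sampling \<open>A\<close> at the nodes returns to the
  cube. An approximate fixed point there is one for \<open>A\<close>, since \<open>A\<close> varies
  little between neighbouring nodes. The time window exceeds one period on both sides to leave room
  for points near a node at the end of the period.\<close>

lemma schauder_periodic_approx:
  fixes A :: "(real \<Rightarrow> real) \<Rightarrow> real \<Rightarrow> real" and T M e :: real
  assumes T: "T > 0" and M: "M > 0" and e: "e > 0"
    and per: "\<And>w t. w \<in> periodic_ball T M \<Longrightarrow> A w (t + T) = A w t"
    and bd: "\<And>w t. w \<in> periodic_ball T M \<Longrightarrow> \<bar>A w t\<bar> \<le> M"
    and uc: "\<And>e. e > 0 \<Longrightarrow> \<exists>d>0. \<forall>w \<in> periodic_ball T M. \<forall>w' \<in> periodic_ball T M.
      (\<forall>s. \<bar>w s - w' s\<bar> \<le> d) \<longrightarrow>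
      (\<forall>t\<in>{-T..2*T}. \<forall>t'\<in>{-T..2*T}. \<bar>t - t'\<bar> \<le> d \<longrightarrow> \<bar>A w t - A w' t'\<bar> \<le> e)"
  obtains w where "w \<in> periodic_ball T M" "\<And>t. \<bar>A w t - w t\<bar> \<le> e"
proof -
  have "e / 3 > 0" using e by simp
  from uc[OF this] obtain d0 where d0: "d0 > 0"
    and "\<forall>w \<in> periodic_ball T M. \<forall>w' \<in> periodic_ball T M. (\<forall>s. \<bar>w s - w' s\<bar> \<le> d0) \<longrightarrow>
      (\<forall>t\<in>{-T..2*T}. \<forall>t'\<in>{-T..2*T}. \<bar>t - t'\<bar> \<le> d0 \<longrightarrow> \<bar>A w t - A w' t'\<bar> \<le> e / 3)"
    by (elim exE conjE)
  note uc0 = this(2)[rule_format]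
  \<comment> \<open>\<open>d0\<close> serves the modulus of \<open>A\<close>, \<open>T\<close> keeps
    points near a node inside the window \<open>{-T..2*T}\<close>, and \<open>e / 3\<close> makes
    the total error \<open>e / 3 + (e / 3 + d)\<close> at most \<open>e\<close>.\<close>
  define d where "d = min (min d0 T) (e / 3)"
  have d: "d > 0" "d \<le> d0" "d \<le> T" "d \<le> e / 3" using d0 T e by (auto simp: d_def)
  from periodic_partition_of_unity[OF T d(1)] obtain n s and h :: "nat \<Rightarrow> real \<Rightarrow> real"
    where "\<forall>j<n. s j \<in> {0..T}"
    "\<forall>j. continuous_on UNIV (h j)" "\<forall>j t. h j (t + T) = h j t" "\<forall>j t. 0 \<le> h j t"
    "\<forall>t. (\<Sum>j<n. h j t) = 1" "\<forall>j t. 0 < h j t \<longrightarrow> (\<exists>k::int. \<bar>t + of_int k * T - s j\<bar> < d)"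
    by (elim exE conjE)
  note s = this(1)[rule_format] and hc = this(2)[rule_format] and hp = this(3)[rule_format]
    and h0 = this(4)[rule_format] and h1 = this(5)[rule_format] and near = this(6)[rule_format]
  define W where "W c t = (\<Sum>j<n. h j t * c j)" for c t
  have W: "W c \<in> periodic_ball T M" if "\<forall>j<n. \<bar>c j\<bar> \<le> M" for c
  proof -
    have "\<bar>W c t\<bar> \<le> M" for t
      using abs_convex_sum_diff_le[of n "\<lambda>j. h j t" c 0 M] h0 h1 that by (auto simp: W_def)
    moreover have "continuous_on UNIV (W c)" unfolding W_def by (intro continuous_intros hc)
    ultimately show ?thesis by (simp add: periodic_ball_def W_def hp)
  qed
  have Wd: "\<bar>W c t - W c' t\<bar> \<le> d" if "\<forall>j<n. \<bar>c j - c' j\<bar> \<le> d" for c c' t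
    using abs_convex_sum_diff_le[of n "\<lambda>j. h j t" "\<lambda>j. c j - c' j" 0 d] h0 h1 that
    by (auto simp: W_def right_diff_distrib sum_subtractf)
  obtain c where c: "\<forall>j<n. \<bar>c j\<bar> \<le> M" and fix_c: "\<forall>i<n. \<bar>A (W c) (s i) - c i\<bar> \<le> e / 3 + d"
  proof (rule cube_approx_fixpoint[OF M d(1), of n "\<lambda>c i. A (W c) (s i)" "e / 3"])
    fix c c' :: "nat \<Rightarrow> real" and i
    assume *: "\<forall>j<n. \<bar>c j\<bar> \<le> M" "\<forall>j<n. \<bar>c' j\<bar> \<le> M" "\<forall>j<n. \<bar>c j - c' j\<bar> \<le> d" "i < n"
    have "\<bar>W c t - W c' t\<bar> \<le> d0" for t using Wd[OF *(3), of t] d(2) by linarith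
    then show "\<bar>A (W c) (s i) - A (W c') (s i)\<bar> \<le> e / 3"
      using * W s[of i] T d0 by (intro uc0) auto
  qed (use W bd in auto)
  show thesis
  proof (rule that[OF W[OF c]])
    fix t
    have "\<bar>(\<Sum>j<n. h j t * c j) - A (W c) t\<bar> \<le> e"
    proof (rule abs_convex_sum_diff_le)
      fix j assume j: "j < n" "0 < h j t"
      obtain k :: int where k: "\<bar>t + of_int k * T - s j\<bar> < d" using near j by blast
      have "\<bar>A (W c) (t + of_int k * T) - A (W c) (s j)\<bar> \<le> e / 3"
        using k s[OF j(1)] d T d0 by (intro uc0 W c) auto
      moreover have "A (W c) (t + of_int k * T) = A (W c) t"
        using per[OF W[OF c]] by (intro periodic_shift) auto
      ultimately show "\<bar>c j - A (W c) t\<bar> \<le> e" using fix_c[rule_format, OF j(1)] d(4) by linarith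
    qed (use h0 h1 in auto)
    then show "\<bar>A (W c) t - W c t\<bar> \<le> e" by (simp add: W_def abs_minus_commute)
  qed
qed

text \<open>The hypothesis \<open>uc\<close> combines uniform continuity of \<open>A\<close> with
  equicontinuity of its image. Equicontinuity yields a uniformly convergent subsequence of
  approximate fixed points, and continuity makes its limit a fixed point.\<close>

theorem schauder_periodic:
  fixes A :: "(real \<Rightarrow> real) \<Rightarrow> real \<Rightarrow> real" and T M :: real
  assumes T: "T > 0" and M: "M > 0"
    and per: "\<And>w t. w \<in> periodic_ball T M \<Longrightarrow> A w (t + T) = A w t"
    and bd: "\<And>w t. w \<in> periodic_ball T M \<Longrightarrow> \<bar>A w t\<bar> \<le> M"
    and uc: "\<And>e. e > 0 \<Longrightarrow> \<exists>d>0. \<forall>w \<in> periodic_ball T M. \<forall>w' \<in> periodic_ball T M.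
      (\<forall>s. \<bar>w s - w' s\<bar> \<le> d) \<longrightarrow>
      (\<forall>t\<in>{-T..2*T}. \<forall>t'\<in>{-T..2*T}. \<bar>t - t'\<bar> \<le> d \<longrightarrow> \<bar>A w t - A w' t'\<bar> \<le> e)"
  obtains w where "w \<in> periodic_ball T M" "\<And>t. A w t = w t"
proof -
  have "\<exists>w. w \<in> periodic_ball T M \<and> (\<forall>t. \<bar>A w t - w t\<bar> \<le> 1 / real (Suc n))" for n
  proof (rule schauder_periodic_approx[OF T M _ per bd uc])
    show "0 < 1 / real (Suc n)" by simp
  qed blast+
  then obtain w where w: "\<And>n. w n \<in> periodic_ball T M" and Aw: "\<And>n t. \<bar>A (w n) t - w n t\<bar> \<le> 1 / real (Suc n)"
    by metis
  have wper: "w n (t + T) = w n t" for n t using w by (simp add: periodic_ball_def)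
  obtain g0 r where g0: "continuous_on {0..T} g0" and r: "strict_mono (r :: nat \<Rightarrow> nat)"
    and lim0: "\<And>e. 0 < e \<Longrightarrow> \<exists>N. \<forall>n x. n \<ge> N \<and> x \<in> {0..T} \<longrightarrow> norm (A (w (r n)) x - g0 x) < e"
  \<comment> \<open>Compactness is applied to the images \<open>A (w n)\<close>, which are
    equicontinuous; the functions \<open>w n\<close> then converge along with them.\<close>
  proof (rule Arzela_Ascoli[of "{0..T}" "\<lambda>n. A (w n)" M])
    fix t e :: real assume t: "t \<in> {0..T}" and e: "0 < e"
    have "e / 2 > 0" using e by simp
    from uc[OF this] obtain d where d: "d > 0"
      and "\<forall>w \<in> periodic_ball T M. \<forall>w' \<in> periodic_ball T M. (\<forall>s. \<bar>w s - w' s\<bar> \<le> d) \<longrightarrow>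
        (\<forall>t\<in>{-T..2*T}. \<forall>t'\<in>{-T..2*T}. \<bar>t - t'\<bar> \<le> d \<longrightarrow> \<bar>A w t - A w' t'\<bar> \<le> e / 2)"
      by (elim exE conjE)
    note dd = this(2)[rule_format]
    have "norm (A (w n) t - A (w n) y) < e" if "y \<in> {0..T}" "norm (t - y) < d" for n y
    proof -
      have "\<bar>A (w n) t - A (w n) y\<bar> \<le> e / 2" using that t T d by (intro dd w) auto
      then show ?thesis using e by auto
    qed
    then show "\<exists>d>0. \<forall>n y. y \<in> {0..T} \<and> norm (t - y) < d \<longrightarrow> norm (A (w n) t - A (w n) y) < e"
      using d by blast
  qed (use bd w in auto)
  \<comment> \<open>A representative of \<open>t\<close> modulo \<open>T\<close> in one period, used
    to carry the limit from \<open>{0..T}\<close> to the line. Periodicity of the limit follows from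
    that of the \<open>w n\<close>.\<close>
  define \<tau> where "\<tau> t = t + of_int (SOME k::int. t + of_int k * T \<in> {0..T}) * T" for t
  have \<tau>: "\<tau> t \<in> {0..T}" for t
  proof -
    have "\<exists>k::int. t + of_int k * T \<in> {0..T}" using shift_into_period[OF T, of t] by auto
    then show ?thesis unfolding \<tau>_def by (rule someI_ex)
  qed
  define g where "g t = g0 (\<tau> t)" for t
  have lim: "\<exists>N. \<forall>n\<ge>N. \<forall>t. \<bar>w (r n) t - g t\<bar> < e" if e: "e > 0" for e
  proof -
    obtain N where N: "\<forall>n x. n \<ge> N \<and> x \<in> {0..T} \<longrightarrow> norm (A (w (r n)) x - g0 x) < e / 2"
      using lim0[of "e / 2"] e by auto
    obtain N' where N': "1 / real (Suc N') < e / 2" using e by (metis half_gt_zero nat_approx_posE)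
    show ?thesis
    proof (intro exI[of _ "max N N'"] allI impI)
      fix n t assume n: "max N N' \<le> n"
      have "w (r n) t = w (r n) (\<tau> t)" unfolding \<tau>_def using wper by (intro periodic_shift[symmetric]) auto
      moreover have "\<bar>A (w (r n)) (\<tau> t) - g0 (\<tau> t)\<bar> < e / 2" using N n \<tau>[of t] by auto
      moreover have "1 / real (Suc (r n)) \<le> 1 / real (Suc N')"
        using n seq_suble[OF r, of n] by (intro divide_left_mono) auto
      ultimately show "\<bar>w (r n) t - g t\<bar> < e"
        using Aw[of "r n" "\<tau> t"] N' unfolding g_def by linarith
    qed
  qed
  have ul: "uniform_limit UNIV (\<lambda>n. w (r n)) g sequentially"
    unfolding uniform_limit_iff dist_real_def eventually_sequentially using lim by auto
  have pt: "(\<lambda>n. w (r n) t) \<longlonglongrightarrow> g t" for t using ul by (rule tendsto_uniform_limitI) simp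
  have g: "g \<in> periodic_ball T M"
  proof -
    have "continuous_on UNIV g"
      using w by (intro uniform_limit_theorem[OF _ ul]) (auto simp: periodic_ball_def)
    moreover have "g (t + T) = g t" for t
      using LIMSEQ_unique[OF pt[of "t + T"]] pt[of t] wper by simp
    moreover have "\<bar>g t\<bar> \<le> M" for t
      by (rule LIMSEQ_le_const2[OF tendsto_rabs[OF pt[of t]]]) (use w in \<open>auto simp: periodic_ball_def\<close>)
    ultimately show ?thesis by (simp add: periodic_ball_def)
  qed
  have fp: "A g t = g t" if t: "t \<in> {0..T}" for t
  proof (rule ccontr)
    assume "A g t \<noteq> g t"
    \<comment> \<open>Three errors of at most \<open>e\<close> separate \<open>A g t\<close> from
      \<open>g t\<close>, so a distance of \<open>4 * e\<close> is impossible.\<close>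
    define e where "e = \<bar>A g t - g t\<bar> / 4"
    have e: "e > 0" using \<open>A g t \<noteq> g t\<close> by (simp add: e_def)
    from uc[OF e] obtain d where d: "d > 0"
      and "\<forall>w \<in> periodic_ball T M. \<forall>w' \<in> periodic_ball T M. (\<forall>s. \<bar>w s - w' s\<bar> \<le> d) \<longrightarrow>
        (\<forall>t\<in>{-T..2*T}. \<forall>t'\<in>{-T..2*T}. \<bar>t - t'\<bar> \<le> d \<longrightarrow> \<bar>A w t - A w' t'\<bar> \<le> e)"
      by (elim exE conjE)
    note dd = this(2)[rule_format]
    obtain N where N: "\<forall>n\<ge>N. \<forall>t. \<bar>w (r n) t - g t\<bar> < min d e" using lim[of "min d e"] d e by auto
    obtain N' where N': "1 / real (Suc N') < e" using e by (metis nat_approx_posE)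
    define n where "n = max N N'"
    have close: "\<bar>w (r n) s - g s\<bar> < min d e" for s using N by (simp add: n_def)
    have "\<bar>A (w (r n)) t - A g t\<bar> \<le> e"
      using close t T d by (intro dd w g) (auto simp: less_imp_le)
    moreover have "1 / real (Suc (r n)) \<le> 1 / real (Suc N')"
      using seq_suble[OF r, of n] by (intro divide_left_mono) (auto simp: n_def)
    ultimately have "\<bar>A g t - g t\<bar> < 4 * e"
      using Aw[of "r n" t] N' close[of t] e by linarith
    then show False by (simp add: e_def)
  qed
  show thesis
  proof (rule that[OF g])
    fix t
    have "A g t = A g (\<tau> t)" "g t = g (\<tau> t)" unfolding \<tau>_def
      using per[OF g] g by (auto intro!: periodic_shift[symmetric] simp: periodic_ball_def)
    then show "A g t = g t" using fp[OF \<tau>] by simp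
  qed
qed

section \<open>Periodic antiderivatives and the delay operator\<close>

text \<open>An antiderivative picked by choice serves both sides of 0 with a single formula, and its
  estimates come from derivative bounds. It is meaningful for continuous \<open>h\<close>.\<close>

definition prim :: "(real \<Rightarrow> real) \<Rightarrow> real \<Rightarrow> real" where
  "prim h = (SOME H. (\<forall>t. (H has_real_derivative h t) (at t)) \<and> H 0 = 0)"

lemma
  assumes "continuous_on UNIV h"
  shows prim_deriv: "(prim h has_real_derivative h t) (at t)" and prim_0: "prim h 0 = 0"
proof -
  obtain F where F: "\<And>x::real. (F has_vector_derivative h x) (at x)"
    using einterval_antiderivative[of "-\<infinity>" "\<infinity>" h] assms
    by (auto simp: continuous_on_eq_continuous_at)
  have "\<exists>H. (\<forall>t. (H has_real_derivative h t) (at t)) \<and> H 0 = 0"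
  proof (intro exI conjI allI)
    fix t show "((\<lambda>t. F t - F 0) has_real_derivative h t) (at t)"
      using F[of t] by (auto intro!: derivative_eq_intros simp: has_real_derivative_iff_has_vector_derivative)
  qed simp
  then have "(\<forall>t. (prim h has_real_derivative h t) (at t)) \<and> prim h 0 = 0"
    unfolding prim_def by (rule someI_ex)
  then show "(prim h has_real_derivative h t) (at t)" "prim h 0 = 0" by auto
qed

lemma real_derivative_lipschitz:
  fixes F f :: "real \<Rightarrow> real"
  assumes "\<And>t. (F has_real_derivative f t) (at t)" "\<And>t. \<bar>f t\<bar> \<le> B"
  shows "\<bar>F s - F t\<bar> \<le> B * \<bar>s - t\<bar>"
  using field_differentiable_bound[of UNIV F f B s t] assms by simp

text \<open>Uniqueness of the antiderivative vanishing at 0: the discrepancy has derivative 0, hence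
  Lipschitz constant 0.\<close>

lemma prim_diff:
  assumes "continuous_on UNIV h" "continuous_on UNIV h'"
  shows "prim (\<lambda>t. h t - h' t) t = prim h t - prim h' t"
proof -
  have c: "continuous_on UNIV (\<lambda>t. h t - h' t)" using assms by (intro continuous_intros)
  define D where "D t = prim (\<lambda>t. h t - h' t) t - (prim h t - prim h' t)" for t
  have "(D has_real_derivative 0) (at t)" for t
    unfolding D_def by (auto intro!: derivative_eq_intros prim_deriv assms c)
  then have "\<bar>D t - D 0\<bar> \<le> 0 * \<bar>t - 0\<bar>" by (rule real_derivative_lipschitz) auto
  then show ?thesis using assms c by (simp add: D_def prim_0)
qed

definition mean :: "real \<Rightarrow> (real \<Rightarrow> real) \<Rightarrow> real" where
  "mean T h = prim h T / T"

text \<open>The antiderivative, vanishing at 0, of \<open>h\<close> minus its mean; removing the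
  mean is what makes it periodic for periodic \<open>h\<close>.\<close>

definition prim0 :: "real \<Rightarrow> (real \<Rightarrow> real) \<Rightarrow> real \<Rightarrow> real" where
  "prim0 T h t = prim h t - t * mean T h"

context
  fixes T :: real
  assumes T: "T > 0"
begin

text \<open>The mean value theorem for \<open>prim h\<close>. It allows the fixed-point equation to
  be evaluated at one time instead of being averaged.\<close>

lemma mean_attained:
  assumes "continuous_on UNIV h"
  obtains z where "mean T h = h z"
proof -
  obtain z where "prim h T - prim h 0 = (T - 0) * h z"
    using MVT2[OF T, of "prim h" h] prim_deriv[OF assms] by blast
  then show thesis using that[of z] T prim_0[OF assms] by (simp add: mean_def)
qed

lemma mean_diff:
  assumes "continuous_on UNIV h" "continuous_on UNIV h'"
  shows "mean T (\<lambda>t. h t - h' t) = mean T h - mean T h'"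
  using prim_diff[OF assms] by (simp add: mean_def diff_divide_distrib)

lemma abs_mean_le:
  assumes "continuous_on UNIV h" "\<And>t. \<bar>h t\<bar> \<le> B"
  shows "\<bar>mean T h\<bar> \<le> B"
  using mean_attained[OF assms(1)] assms(2) by metis

lemma prim0_deriv:
  assumes "continuous_on UNIV h"
  shows "(prim0 T h has_real_derivative h t - mean T h) (at t)"
  unfolding prim0_def[abs_def] by (auto intro!: derivative_eq_intros prim_deriv assms)

lemma continuous_prim0:
  assumes "continuous_on UNIV h"
  shows "continuous_on UNIV (prim0 T h)"
  by (meson DERIV_isCont continuous_at_imp_continuous_on prim0_deriv[OF assms])

lemma prim0_diff:
  assumes "continuous_on UNIV h" "continuous_on UNIV h'"
  shows "prim0 T (\<lambda>t. h t - h' t) t = prim0 T h t - prim0 T h' t"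
  by (simp add: prim0_def prim_diff[OF assms] mean_diff[OF assms] right_diff_distrib)

text \<open>The increment over one period has derivative 0, and it vanishes at time 0 by the choice
  of the mean.\<close>

lemma prim0_periodic:
  assumes h: "continuous_on UNIV h" and per: "\<forall>t. h (t + T) = h t"
  shows "prim0 T h (t + T) = prim0 T h t"
proof -
  define D where "D t = prim0 T h (t + T) - prim0 T h t" for t
  have "((\<lambda>t. prim0 T h (t + T)) has_real_derivative h (t + T) - mean T h) (at t)" for t
    using prim0_deriv[OF h, of "t + T"] by (simp add: DERIV_shift)
  then have "(D has_real_derivative 0) (at t)" for t
    unfolding D_def using prim0_deriv[OF h, of t] per
    by (auto intro!: derivative_eq_intros)
  then have "\<bar>D t - D 0\<bar> \<le> 0 * \<bar>t - 0\<bar>" by (rule real_derivative_lipschitz) auto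
  moreover have "D 0 = 0" using T prim_0[OF h] by (simp add: D_def prim0_def mean_def)
  ultimately show ?thesis by (simp add: D_def)
qed

text \<open>After a shift into one period, the antiderivative and the subtracted linear term are
  each at most \<open>T * B\<close>. The factor \<open>T\<close> is the source of all smallness at
  high frequency.\<close>

lemma abs_prim0_le:
  assumes h: "continuous_on UNIV h" and per: "\<forall>t. h (t + T) = h t" and B: "\<And>t. \<bar>h t\<bar> \<le> B"
  shows "\<bar>prim0 T h t\<bar> \<le> 2 * T * B"
proof -
  obtain k :: int where k: "0 \<le> t + of_int k * T" "t + of_int k * T \<le> T"
    using shift_into_period[OF T] by blast
  define s where "s = t + of_int k * T"
  have "0 \<le> B" using B[of 0] by linarith
  have "\<bar>prim h s - prim h 0\<bar> \<le> B * \<bar>s - 0\<bar>"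
    by (rule real_derivative_lipschitz[OF prim_deriv[OF h] B])
  also have "\<dots> \<le> B * T" using k \<open>0 \<le> B\<close> by (intro mult_left_mono) (auto simp: s_def)
  finally have "\<bar>prim h s\<bar> \<le> B * T" by (simp add: prim_0[OF h])
  moreover have "\<bar>s * mean T h\<bar> \<le> T * B"
    unfolding abs_mult using k \<open>0 \<le> B\<close> abs_mean_le[OF h B] by (intro mult_mono) (auto simp: s_def)
  ultimately have "\<bar>prim0 T h s\<bar> \<le> 2 * T * B" unfolding prim0_def by (simp add: algebra_simps)
  moreover have "prim0 T h s = prim0 T h t"
    unfolding s_def using prim0_periodic[OF h per] by (intro periodic_shift) auto
  ultimately show ?thesis by simp
qed

end

text \<open>The memory term as the expectation of \<open>\<psi> (t - r)\<close> over a random delay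
  \<open>r\<close> with gamma distribution. The total mass 1 then gives its bounds.\<close>

definition delay :: "real \<Rightarrow> nat \<Rightarrow> (real \<Rightarrow> real) \<Rightarrow> real \<Rightarrow> real" where
  "delay a b \<psi> t = (LINT r|density lborel (gamma_density a b). \<psi> (t - r))"

lemma delay_eq_integral:
  assumes a: "a > 0" and \<psi>: "continuous_on UNIV \<psi>"
  shows "(LINT s:{..t}|lborel. gamma_density a b (t - s) * \<psi> s) = delay a b \<psi> t"
proof -
  have [measurable]: "\<psi> \<in> borel_measurable borel"
    using \<psi> by (rule borel_measurable_continuous_onI)
  have [measurable]: "gamma_density a b \<in> borel_measurable borel" by (simp add: gamma_density_def)
  have "(LINT s:{..t}|lborel. gamma_density a b (t - s) * \<psi> s)
      = (LINT s|lborel. gamma_density a b (t - s) * \<psi> s)"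
    unfolding set_lebesgue_integral_def
    by (intro Bochner_Integration.integral_cong refl)
      (auto simp: indicator_def gamma_density_def erlang_density_def)
  also have "\<dots> = (LINT r|lborel. gamma_density a b r * \<psi> (t - r))"
    by (subst lborel_integral_real_affine[where c = "-1" and t = t]) auto
  also have "\<dots> = delay a b \<psi> t"
    unfolding delay_def using a
    by (subst integral_density) (auto simp: gamma_density_def intro!: AE_I2)
  finally show ?thesis .
qed

text \<open>Averaging against a probability measure fixes constants and does not increase distances.
  The integrands are compared at equal delay \<open>r\<close>, so one estimate covers changes of the
  function and of the time.\<close>

lemma
  assumes a: "a > 0"
  shows delay_const: "delay a b (\<lambda>_. c) t = c"
    and abs_delay_diff_le: "\<lbrakk>continuous_on UNIV \<psi>; continuous_on UNIV \<psi>'; \<And>s. \<bar>\<psi> s\<bar> \<le> B; \<And>s. \<bar>\<psi>' s\<bar> \<le> B;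
      \<And>r. \<bar>\<psi> (t - r) - \<psi>' (t' - r)\<bar> \<le> e\<rbrakk> \<Longrightarrow> \<bar>delay a b \<psi> t - delay a b \<psi>' t'\<bar> \<le> e"
proof -
  interpret prob_space "density lborel (gamma_density a b)"
    unfolding gamma_density_def using a by (rule prob_space_erlang_density)
  show "delay a b (\<lambda>_. c) t = c" using prob_space by (simp add: delay_def)
  assume c: "continuous_on UNIV \<psi>" "continuous_on UNIV \<psi>'"
    and B: "\<And>s. \<bar>\<psi> s\<bar> \<le> B" "\<And>s. \<bar>\<psi>' s\<bar> \<le> B" and e: "\<And>r. \<bar>\<psi> (t - r) - \<psi>' (t' - r)\<bar> \<le> e"
  have [measurable]: "\<psi> \<in> borel_measurable borel" "\<psi>' \<in> borel_measurable borel"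
    using c by (auto intro: borel_measurable_continuous_onI)
  have i: "integrable (density lborel (gamma_density a b)) (\<lambda>r. \<psi> (t - r))"
    "integrable (density lborel (gamma_density a b)) (\<lambda>r. \<psi>' (t' - r))"
    using B by (auto intro!: integrable_const_bound[where B = B])
  have "delay a b \<psi> t - delay a b \<psi>' t' = expectation (\<lambda>r. \<psi> (t - r) - \<psi>' (t' - r))"
    unfolding delay_def using i by simp
  also have "\<bar>\<dots>\<bar> \<le> expectation (\<lambda>r. \<bar>\<psi> (t - r) - \<psi>' (t' - r)\<bar>)" by (rule integral_abs_bound)
  also have "\<dots> \<le> e" using i e by (intro integral_le_const) auto
  finally show "\<bar>delay a b \<psi> t - delay a b \<psi>' t'\<bar> \<le> e" .
qed

lemma abs_delay_le:
  assumes "a > 0" "continuous_on UNIV \<psi>" "\<And>s. \<bar>\<psi> s\<bar> \<le> B"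
  shows "\<bar>delay a b \<psi> t\<bar> \<le> B"
proof -
  have "0 \<le> B" using assms(3)[of 0] by linarith
  then show ?thesis
    using abs_delay_diff_le[OF assms(1,2), of "\<lambda>_. 0" B t t B] assms by (simp add: delay_const)
qed

section \<open>The delayed vector field\<close>

lemma locally_lipschitz_imp_continuous:
  assumes "locally_lipschitz h"
  shows "continuous_on UNIV h"
proof -
  have "isCont h x" for x
  proof -
    obtain \<epsilon> L where "\<epsilon> > 0" "L-lipschitz_on (ball x \<epsilon>) h"
      using assms unfolding locally_lipschitz_def by blast
    then show ?thesis
      using lipschitz_on_continuous_on continuous_on_interior[of "ball x \<epsilon>" h x] by force
  qed
  then show ?thesis by (simp add: continuous_at_imp_continuous_on)
qed

section \<open>Compactness bounds, moduli of continuity and sign changes\<close>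

lemma compact_abs_bound:
  fixes h :: "'a::topological_space \<Rightarrow> real"
  assumes "compact K" "continuous_on K h"
  obtains B where "B > 0" "\<And>x. x \<in> K \<Longrightarrow> \<bar>h x\<bar> \<le> B"
  using compact_imp_bounded[OF compact_continuous_image[OF assms(2,1)]] that
  by (auto simp: bounded_pos)

lemma dist_Pair_le: "dist (a, b) (c, d) \<le> dist a c + dist b d"
  unfolding dist_Pair_Pair by (intro sqrt_sum_squares_le_sum) auto

lemma modulus_of_continuity_2:
  fixes h :: "real \<times> real \<Rightarrow> real"
  assumes "continuous_on UNIV h" "compact A" "compact B" "e > 0"
  obtains d where "d > 0" "\<And>x x' y y'. \<lbrakk>x \<in> A; x' \<in> A; y \<in> B; y' \<in> B; \<bar>x - x'\<bar> \<le> d; \<bar>y - y'\<bar> \<le> d\<rbrakk>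
    \<Longrightarrow> \<bar>h (x, y) - h (x', y')\<bar> \<le> e"
proof -
  have "uniformly_continuous_on (A \<times> B) h"
    using assms by (intro compact_uniformly_continuous compact_Times) (auto intro: continuous_on_subset)
  then obtain d where d: "d > 0" "\<And>z z'. z \<in> A \<times> B \<Longrightarrow> z' \<in> A \<times> B \<Longrightarrow> dist z' z < d \<Longrightarrow> dist (h z') (h z) < e"
    unfolding uniformly_continuous_on_def using assms(4) by blast
  show thesis
  proof (rule that[of "d / 3"])
    fix x x' y y' assume *: "x \<in> A" "x' \<in> A" "y \<in> B" "y' \<in> B" "\<bar>x - x'\<bar> \<le> d / 3" "\<bar>y - y'\<bar> \<le> d / 3"
    have "dist (x, y) (x', y') \<le> dist x x' + dist y y'" by (rule dist_Pair_le)
    also have "\<dots> < d" using * d(1) unfolding dist_real_def by linarith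
    finally have "dist (h (x, y)) (h (x', y')) < e" using * d(2) by auto
    then show "\<bar>h (x, y) - h (x', y')\<bar> \<le> e" by (simp add: dist_real_def)
  qed (use d in simp)
qed

lemma modulus_of_continuity_3:
  fixes h :: "real \<times> real \<times> real \<Rightarrow> real"
  assumes "continuous_on UNIV h" "compact A" "compact B" "compact C" "e > 0"
  obtains d where "d > 0" "\<And>x x' y y' z z'. \<lbrakk>x \<in> A; x' \<in> A; y \<in> B; y' \<in> B; z \<in> C; z' \<in> C;
      \<bar>x - x'\<bar> \<le> d; \<bar>y - y'\<bar> \<le> d; \<bar>z - z'\<bar> \<le> d\<rbrakk>
    \<Longrightarrow> \<bar>h (x, y, z) - h (x', y', z')\<bar> \<le> e"
proof -
  have "uniformly_continuous_on (A \<times> B \<times> C) h"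
    using assms by (intro compact_uniformly_continuous compact_Times) (auto intro: continuous_on_subset)
  then obtain d where d: "d > 0" "\<And>z z'. z \<in> A \<times> B \<times> C \<Longrightarrow> z' \<in> A \<times> B \<times> C \<Longrightarrow> dist z' z < d \<Longrightarrow> dist (h z') (h z) < e"
    unfolding uniformly_continuous_on_def using assms(5) by blast
  show thesis
  proof (rule that[of "d / 4"])
    fix x x' y y' z z' assume *: "x \<in> A" "x' \<in> A" "y \<in> B" "y' \<in> B" "z \<in> C" "z' \<in> C"
      "\<bar>x - x'\<bar> \<le> d / 4" "\<bar>y - y'\<bar> \<le> d / 4" "\<bar>z - z'\<bar> \<le> d / 4"
    have "dist (x, y, z) (x', y', z') \<le> dist x x' + dist (y, z) (y', z')" by (rule dist_Pair_le)
    also have "dist (y, z) (y', z') \<le> dist y y' + dist z z'" by (rule dist_Pair_le)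
    finally have "dist (x, y, z) (x', y', z') < d" using * d(1) unfolding dist_real_def by linarith
    then have "dist (h (x, y, z)) (h (x', y', z')) < e" using * d(2) by auto
    then show "\<bar>h (x, y, z) - h (x', y', z')\<bar> \<le> e" by (simp add: dist_real_def)
  qed (use d in simp)
qed

text \<open>The factor \<open>\<sigma>\<close> records the direction of the sign change, so that
  afterwards both directions are treated as a decreasing crossing.\<close>

lemma changes_sign_obtain:
  assumes "changes_sign_at_isolated_zero F p" "e > 0"
  obtains \<sigma> \<epsilon> :: real where "\<sigma> = 1 \<or> \<sigma> = -1" "0 < \<epsilon>" "\<epsilon> < e" "\<sigma> * F (p - \<epsilon>) > 0" "\<sigma> * F (p + \<epsilon>) < 0"
proof -
  note result = that
  have key: thesis if ev: "\<forall>\<^sub>F u in at_left p. s * F u > 0" "\<forall>\<^sub>F u in at_right p. s * F u < 0"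
    and s: "s = 1 \<or> s = -1" for s
  proof -
    obtain l r where l: "l < p" "\<And>y. l < y \<Longrightarrow> y < p \<Longrightarrow> s * F y > 0"
      and r: "r > p" "\<And>y. p < y \<Longrightarrow> y < r \<Longrightarrow> s * F y < 0"
      using ev unfolding eventually_at_left_field eventually_at_right_field by metis
    define \<epsilon> where "\<epsilon> = min e (min (p - l) (r - p)) / 2"
    have "0 < \<epsilon>" "\<epsilon> < e" "\<epsilon> < p - l" "\<epsilon> < r - p" using assms(2) l(1) r(1) by (auto simp: \<epsilon>_def)
    then show thesis using l r s by (intro result[of s \<epsilon>]) auto
  qed
  from assms(1) consider "\<forall>\<^sub>F u in at_left p. F u > 0" "\<forall>\<^sub>F u in at_right p. F u < 0"
    | "\<forall>\<^sub>F u in at_left p. F u < 0" "\<forall>\<^sub>F u in at_right p. F u > 0"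
    unfolding changes_sign_at_isolated_zero_def by blast
  then show thesis
  proof cases
    case 1 then show ?thesis by (intro key[of 1]) auto
  next
    case 2 then show ?thesis by (intro key[of "-1"]) auto
  qed
qed

text \<open>The radii 2 and 1 are fixed in advance, so that bounds for the field over the tube are
  available before the period and the forcing are known.\<close>

definition tube :: "real \<Rightarrow> (real \<Rightarrow> real) \<Rightarrow> (real \<Rightarrow> real) \<Rightarrow> bool" where
  "tube p x v \<longleftrightarrow> continuous_on UNIV x \<and> continuous_on UNIV v \<and> (\<forall>t. \<bar>x t - p\<bar> \<le> 2 \<and> \<bar>v t\<bar> \<le> 1)"

text \<open>The right-hand side without forcing, along a position \<open>x\<close> and a velocity
  \<open>v\<close>. On the constant state \<open>u\<close> with velocity 0 it equals
  \<open>g (u, 0, \<phi> (u, 0))\<close>.\<close>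

definition delay_field :: "real \<Rightarrow> nat \<Rightarrow> (real \<times> real \<times> real \<Rightarrow> real) \<Rightarrow> (real \<times> real \<Rightarrow> real)
    \<Rightarrow> (real \<Rightarrow> real) \<Rightarrow> (real \<Rightarrow> real) \<Rightarrow> real \<Rightarrow> real" where
  "delay_field a b g \<phi> x v t = g (x t, v t, delay a b (\<lambda>s. \<phi> (x s, v s)) t)"

lemma tube_box:
  assumes "tube p x v"
  shows "x s \<in> {p-2..p+2}" "v s \<in> {-1..1}"
proof -
  have "\<bar>x s - p\<bar> \<le> 2" "\<bar>v s\<bar> \<le> 1" using assms by (auto simp: tube_def)
  then show "x s \<in> {p-2..p+2}" "v s \<in> {-1..1}" unfolding atLeastAtMost_iff by linarith+
qed

context
  fixes a p :: real and b :: nat and g :: "real \<times> real \<times> real \<Rightarrow> real" and \<phi> :: "real \<times> real \<Rightarrow> real"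
  assumes a: "a > 0" and g: "continuous_on UNIV g" and \<phi>: "continuous_on UNIV \<phi>"
begin

lemma tube_compose_continuous:
  assumes "tube p x v"
  shows "continuous_on UNIV (\<lambda>s. \<phi> (x s, v s))"
  using assms \<phi> unfolding tube_def
  by (intro continuous_on_compose2[OF \<phi>]) (auto intro!: continuous_intros)

lemma tube_memory_bound:
  obtains m where "m > 0" "\<And>x v s. tube p x v \<Longrightarrow> \<bar>\<phi> (x s, v s)\<bar> \<le> m"
proof -
  have "compact ({p-2..p+2} \<times> {-1..1::real})" by (intro compact_Times compact_Icc)
  then obtain m where "m > 0" "\<And>z. z \<in> {p-2..p+2} \<times> {-1..1} \<Longrightarrow> \<bar>\<phi> z\<bar> \<le> m"
    using compact_abs_bound continuous_on_subset[OF \<phi> subset_UNIV] by blast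
  then show thesis using tube_box by (intro that[of m]) blast+
qed

lemma delay_field_bound:
  obtains M where "M > 0" "\<And>x v t. tube p x v \<Longrightarrow> \<bar>delay_field a b g \<phi> x v t\<bar> \<le> M"
proof -
  obtain m where m: "m > 0" "\<And>x v s. tube p x v \<Longrightarrow> \<bar>\<phi> (x s, v s)\<bar> \<le> m" using tube_memory_bound by blast
  have "compact ({p-2..p+2} \<times> {-1..1::real} \<times> {-m..m})" by (intro compact_Times compact_Icc)
  then obtain M where M: "M > 0" "\<And>z. z \<in> {p-2..p+2} \<times> {-1..1} \<times> {-m..m} \<Longrightarrow> \<bar>g z\<bar> \<le> M"
    using compact_abs_bound continuous_on_subset[OF g subset_UNIV] by blast
  show thesis
  proof (rule that[OF M(1)])
    fix x v t assume xv: "tube p x v"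
    have "\<bar>delay a b (\<lambda>s. \<phi> (x s, v s)) t\<bar> \<le> m"
      using m xv by (intro abs_delay_le a tube_compose_continuous) auto
    then show "\<bar>delay_field a b g \<phi> x v t\<bar> \<le> M"
      unfolding delay_field_def using tube_box[OF xv, of t] by (intro M) (auto simp: abs_le_iff)
  qed
qed

text \<open>Closeness of whole histories, seen from possibly different times, controls the field.
  This one form gives continuity in the function, equicontinuity in time and comparison with
  constant states.\<close>

lemma delay_field_modulus:
  assumes "e > 0"
  obtains d where "d > 0" "\<And>x v x' v' t t'. \<lbrakk>tube p x v; tube p x' v';
      \<And>r. \<bar>x (t - r) - x' (t' - r)\<bar> \<le> d; \<And>r. \<bar>v (t - r) - v' (t' - r)\<bar> \<le> d\<rbrakk>
      \<Longrightarrow> \<bar>delay_field a b g \<phi> x v t - delay_field a b g \<phi> x' v' t'\<bar> \<le> e"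
proof -
  obtain m where m: "m > 0" "\<And>x v s. tube p x v \<Longrightarrow> \<bar>\<phi> (x s, v s)\<bar> \<le> m" using tube_memory_bound by blast
  obtain d1 where d1: "d1 > 0" "\<And>x x' y y' z z'. \<lbrakk>x \<in> {p-2..p+2}; x' \<in> {p-2..p+2}; y \<in> {-1..1}; y' \<in> {-1..1};
      z \<in> {-m..m}; z' \<in> {-m..m}; \<bar>x - x'\<bar> \<le> d1; \<bar>y - y'\<bar> \<le> d1; \<bar>z - z'\<bar> \<le> d1\<rbrakk>
    \<Longrightarrow> \<bar>g (x, y, z) - g (x', y', z')\<bar> \<le> e"
    using modulus_of_continuity_3[OF g _ _ _ assms, of "{p-2..p+2}" "{-1..1}" "{-m..m}"] by (metis compact_Icc)
  obtain d2 where d2: "d2 > 0" "\<And>x x' y y'. \<lbrakk>x \<in> {p-2..p+2}; x' \<in> {p-2..p+2}; y \<in> {-1..1}; y' \<in> {-1..1};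
      \<bar>x - x'\<bar> \<le> d2; \<bar>y - y'\<bar> \<le> d2\<rbrakk> \<Longrightarrow> \<bar>\<phi> (x, y) - \<phi> (x', y')\<bar> \<le> d1"
    using modulus_of_continuity_2[OF \<phi> _ _ d1(1), of "{p-2..p+2}" "{-1..1}"] by (metis compact_Icc)
  show thesis
  proof (rule that[of "min d1 d2"])
    fix x v x' v' t t'
    assume xv: "tube p x v" "tube p x' v'" and close: "\<And>r. \<bar>x (t - r) - x' (t' - r)\<bar> \<le> min d1 d2"
      "\<And>r. \<bar>v (t - r) - v' (t' - r)\<bar> \<le> min d1 d2"
    note box = xv[THEN tube_box(1)] xv[THEN tube_box(2)]
    have "\<bar>delay a b (\<lambda>s. \<phi> (x s, v s)) t - delay a b (\<lambda>s. \<phi> (x' s, v' s)) t'\<bar> \<le> d1"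
      using m(2) xv close box by (intro abs_delay_diff_le[where B = m] a tube_compose_continuous d2) auto
    moreover have "\<bar>delay a b (\<lambda>s. \<phi> (x s, v s)) t\<bar> \<le> m" "\<bar>delay a b (\<lambda>s. \<phi> (x' s, v' s)) t'\<bar> \<le> m"
      using m xv by (auto intro!: abs_delay_le a tube_compose_continuous)
    \<comment> \<open>The present values are the case \<open>r = 0\<close> of the closeness of
      histories.\<close>
    ultimately show "\<bar>delay_field a b g \<phi> x v t - delay_field a b g \<phi> x' v' t'\<bar> \<le> e"
      unfolding delay_field_def using box close(1)[of 0] close(2)[of 0]
      by (intro d1) (auto simp: abs_le_iff)
  qed (use d1 d2 in auto)
qed

end

section \<open>Periodic solutions near a zero\<close>

text \<open>The mean of the first antiderivative is removed so that a further integration is again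
  periodic. \<open>prim0\<close> removes the same mean in \<open>disp\<close>, whose derivative is
  therefore \<open>vel\<close>.\<close>

definition vel :: "real \<Rightarrow> real \<Rightarrow> (real \<Rightarrow> real) \<Rightarrow> real \<Rightarrow> real" where
  "vel \<sigma> T w t = \<sigma> * (prim0 T w t - mean T (prim0 T w))"

definition disp :: "real \<Rightarrow> real \<Rightarrow> (real \<Rightarrow> real) \<Rightarrow> real \<Rightarrow> real" where
  "disp \<sigma> T w t = \<sigma> * prim0 T (prim0 T w) t"

context
  fixes T \<sigma> :: real
  assumes T: "T > 0" and \<sigma>: "\<sigma> = 1 \<or> \<sigma> = -1"
begin

lemma vel_deriv: "continuous_on UNIV w \<Longrightarrow> (vel \<sigma> T w has_real_derivative \<sigma> * (w t - mean T w)) (at t)"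
  unfolding vel_def[abs_def] by (auto intro!: derivative_eq_intros prim0_deriv T)

lemma disp_deriv: "continuous_on UNIV w \<Longrightarrow> (disp \<sigma> T w has_real_derivative vel \<sigma> T w t) (at t)"
  unfolding vel_def disp_def[abs_def]
  by (auto intro!: derivative_eq_intros prim0_deriv continuous_prim0 T)

lemma continuous_vel: "continuous_on UNIV w \<Longrightarrow> continuous_on UNIV (vel \<sigma> T w)"
  and continuous_disp: "continuous_on UNIV w \<Longrightarrow> continuous_on UNIV (disp \<sigma> T w)"
  by (meson DERIV_isCont continuous_at_imp_continuous_on vel_deriv disp_deriv)+

lemma
  assumes c: "continuous_on UNIV w" "continuous_on UNIV w'"
  shows vel_diff: "vel \<sigma> T (\<lambda>t. w t - w' t) t = vel \<sigma> T w t - vel \<sigma> T w' t"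
    and disp_diff: "disp \<sigma> T (\<lambda>t. w t - w' t) t = disp \<sigma> T w t - disp \<sigma> T w' t"
proof -
  note cp = continuous_prim0[OF T c(1)] continuous_prim0[OF T c(2)]
  have eq: "prim0 T (\<lambda>t. w t - w' t) = (\<lambda>t. prim0 T w t - prim0 T w' t)"
    by (rule ext) (rule prim0_diff[OF T c])
  show "vel \<sigma> T (\<lambda>t. w t - w' t) t = vel \<sigma> T w t - vel \<sigma> T w' t"
    unfolding vel_def eq mean_diff[OF T cp] by (simp add: algebra_simps)
  show "disp \<sigma> T (\<lambda>t. w t - w' t) t = disp \<sigma> T w t - disp \<sigma> T w' t"
    unfolding disp_def eq prim0_diff[OF T cp] by (simp add: algebra_simps)
qed

lemma
  assumes w: "continuous_on UNIV w" and per: "\<forall>t. w (t + T) = w t"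
  shows vel_periodic: "vel \<sigma> T w (t + T) = vel \<sigma> T w t"
    and disp_periodic: "disp \<sigma> T w (t + T) = disp \<sigma> T w t"
  using prim0_periodic[OF T w per]
    prim0_periodic[OF T continuous_prim0[OF T w], of t]
  by (simp_all add: vel_def disp_def)

text \<open>Each integration by \<open>prim0\<close> gains a factor \<open>2 * T\<close>; for the
  velocity, the subtracted mean doubles the bound.\<close>

lemma
  assumes w: "continuous_on UNIV w" and per: "\<forall>t. w (t + T) = w t" and B: "\<And>t. \<bar>w t\<bar> \<le> B"
  shows abs_vel_le: "\<bar>vel \<sigma> T w t\<bar> \<le> 4 * T * B"
    and abs_disp_le: "\<bar>disp \<sigma> T w t\<bar> \<le> 4 * T * T * B"
proof -
  note c = continuous_prim0[OF T w]
  note P = abs_prim0_le[OF T w per B]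
  have "\<bar>prim0 T w t\<bar> \<le> 2 * T * B" "\<bar>mean T (prim0 T w)\<bar> \<le> 2 * T * B"
    using P abs_mean_le[OF T c P] by auto
  then show "\<bar>vel \<sigma> T w t\<bar> \<le> 4 * T * B" using \<sigma> by (auto simp: vel_def)
  show "\<bar>disp \<sigma> T w t\<bar> \<le> 4 * T * T * B"
    using abs_prim0_le[OF T c _ P, of t] prim0_periodic[OF T w per] \<sigma> by (auto simp: disp_def)
qed

end

lemma periodic_bounded_forcing:
  fixes f :: "real \<times> real \<times> real \<Rightarrow> real" and T :: real
  assumes T: "T > 0" and f: "continuous_on UNIV f" and per: "\<forall>t u v. f (t + T, u, v) = f (t, u, v)"
    and K: "compact A" "compact B"
  obtains F where "F > 0" "\<And>t u v. u \<in> A \<Longrightarrow> v \<in> B \<Longrightarrow> \<bar>f (t, u, v)\<bar> \<le> F"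
proof -
  have "compact ({0..T} \<times> A \<times> B)" using K by (intro compact_Times compact_Icc)
  then obtain F where F: "F > 0" "\<And>z. z \<in> {0..T} \<times> A \<times> B \<Longrightarrow> \<bar>f z\<bar> \<le> F"
    using compact_abs_bound continuous_on_subset[OF f subset_UNIV] by blast
  show thesis
  proof (rule that[OF F(1)])
    fix t u v assume uv: "u \<in> A" "v \<in> B"
    obtain k :: int where k: "0 \<le> t + of_int k * T" "t + of_int k * T \<le> T"
      using shift_into_period[OF T] by blast
    have "f (t + of_int k * T, u, v) = f (t, u, v)"
      using periodic_shift[of "\<lambda>t. f (t, u, v)" T t k] per by simp
    then show "\<bar>f (t, u, v)\<bar> \<le> F" using F(2)[of "(t + of_int k * T, u, v)"] k uv by simp
  qed
qed

text \<open>\<open>T0\<close> comes from bounds on the unforced field near \<open>p\<close>, before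
  \<open>T\<close> and \<open>f\<close> are given; \<open>l0\<close> is chosen afterwards from a
  bound on \<open>f\<close>.\<close>

lemma periodic_solution_near_zero:
  fixes a e0 p :: real
  assumes a: "a > 0" and g: "continuous_on UNIV g" and \<phi>: "continuous_on UNIV \<phi>"
    and sign: "changes_sign_at_isolated_zero (\<lambda>u. g (u, 0, \<phi> (u, 0))) p" and e0: "e0 > 0"
  obtains T0 where "T0 > 0"
    "\<And>T f. \<lbrakk>0 < T; T < T0; continuous_on UNIV f; \<forall>t u v. f (t + T, u, v) = f (t, u, v)\<rbrakk>
      \<Longrightarrow> \<exists>l0>0. \<forall>l. 0 < l \<and> l < l0 \<longrightarrow> (\<exists>x. periodic_solution a b g \<phi> l f T x \<and> (\<forall>t. \<bar>x t - p\<bar> < e0))"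
proof -
  define \<Phi> where "\<Phi> u = g (u, 0, \<phi> (u, 0))" for u
  obtain \<sigma> \<epsilon> where \<sigma>: "\<sigma> = 1 \<or> \<sigma> = -1" and \<epsilon>: "0 < \<epsilon>" "\<epsilon> < min 1 (e0 / 2)"
    and s: "\<sigma> * \<Phi> (p - \<epsilon>) > 0" "\<sigma> * \<Phi> (p + \<epsilon>) < 0"
    using changes_sign_obtain[OF sign, of "min 1 (e0 / 2)"] e0 unfolding \<Phi>_def by auto
  \<comment> \<open>A third of the smaller sign margin: the field's deviation from
    \<open>\<Phi>\<close> and the forcing each use up one \<open>\<eta>\<close>, and one
    remains.\<close>
  define \<eta> where "\<eta> = min (\<sigma> * \<Phi> (p - \<epsilon>)) (- (\<sigma> * \<Phi> (p + \<epsilon>))) / 3"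
  have \<eta>: "\<eta> > 0" "\<sigma> * \<Phi> (p - \<epsilon>) \<ge> 3 * \<eta>" "\<sigma> * \<Phi> (p + \<epsilon>) \<le> - 3 * \<eta>" using s by (auto simp: \<eta>_def)
  obtain d where d: "d > 0" and dd: "\<And>x v x' v' t t'. \<lbrakk>tube p x v; tube p x' v';
      \<And>r. \<bar>x (t - r) - x' (t' - r)\<bar> \<le> d; \<And>r. \<bar>v (t - r) - v' (t' - r)\<bar> \<le> d\<rbrakk>
      \<Longrightarrow> \<bar>delay_field a b g \<phi> x v t - delay_field a b g \<phi> x' v' t'\<bar> \<le> \<eta>"
    using delay_field_modulus[OF a g \<phi> \<eta>(1), of p b] by blast
  have field_const: "delay_field a b g \<phi> (\<lambda>_. u) (\<lambda>_. 0) t = \<Phi> u" for u t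
    by (simp add: delay_field_def delay_const[OF a] \<Phi>_def)
  obtain M0 where M0: "M0 > 0" "\<And>x v t. tube p x v \<Longrightarrow> \<bar>delay_field a b g \<phi> x v t\<bar> \<le> M0"
    using delay_field_bound[OF a g \<phi>, of p b] by blast
  \<comment> \<open>\<open>M0\<close> bounds the field, and the forcing and the truncated mean
    contribute at most 1 each.\<close>
  define M where "M = M0 + 2"
  \<comment> \<open>\<open>d\<close> gives accuracy \<open>\<eta>\<close> for the field, and
    \<open>\<epsilon>\<close> keeps the solution within \<open>2 * \<epsilon>\<close>, hence
    \<open>e0\<close>, of \<open>p\<close>.\<close>
  define \<delta> where "\<delta> = min d \<epsilon>"
  have M: "M > 0" and \<delta>: "\<delta> > 0" "\<delta> \<le> d" "\<delta> \<le> \<epsilon>" using M0 d \<epsilon> by (auto simp: M_def \<delta>_def)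
  show thesis
  \<comment> \<open>This makes the velocity bound \<open>4 * T * M\<close> at most
    \<open>\<delta>\<close>; the displacement bound is smaller because \<open>T\<close> is at most
    1.\<close>
  proof (rule that[of "min 1 (\<delta> / (4 * M))"])
    show "min 1 (\<delta> / (4 * M)) > 0" using M \<delta> by simp
    fix T :: real and f :: "real \<times> real \<times> real \<Rightarrow> real"
    assume T: "0 < T" and "T < min 1 (\<delta> / (4 * M))" and f: "continuous_on UNIV f"
      and fper: "\<forall>t u v. f (t + T, u, v) = f (t, u, v)"
    then have T1: "T \<le> 1" and TM: "4 * T * M \<le> \<delta>" using M by (auto simp: field_simps)
    have "T * (4 * T * M) \<le> 1 * (4 * T * M)" using T1 T M by (intro mult_right_mono) auto
    then have TTM: "4 * T * T * M \<le> \<delta>" using TM by (simp add: algebra_simps)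
    obtain F where F: "F > 0" "\<And>t u v. u \<in> {p-2..p+2} \<Longrightarrow> v \<in> {-1..1} \<Longrightarrow> \<bar>f (t, u, v)\<bar> \<le> F"
      using periodic_bounded_forcing[OF T f fper compact_Icc compact_Icc] by blast
    \<comment> \<open>The forcing stays below \<open>\<eta>\<close> for the sign argument and below
      1 for the invariance of the ball.\<close>
    define l0 where "l0 = min \<eta> 1 / F"
    have "\<exists>x. periodic_solution a b g \<phi> l f T x \<and> (\<forall>t. \<bar>x t - p\<bar> < e0)" if l: "0 < l" "l < l0" for l
    proof -
      have lF: "l * F \<le> min \<eta> 1" using l F(1) unfolding l0_def by (simp add: pos_less_divide_eq less_imp_le)
      have lf: "\<bar>l * f (t, u, v)\<bar> \<le> min \<eta> 1" if "u \<in> {p-2..p+2}" "v \<in> {-1..1}" for t u v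
      proof -
        have "\<bar>l * f (t, u, v)\<bar> \<le> l * F" using F(2)[OF that, of t] l by (simp add: abs_mult)
        then show ?thesis using lF by linarith
      qed
      \<comment> \<open>Truncation is 1-Lipschitz in the mean, and it keeps \<open>x w\<close>
        inside the tube for every \<open>w\<close> in the ball.\<close>
      define c where "c w = max (- \<epsilon>) (min \<epsilon> (mean T w))" for w
      define x where "x w t = p + c w + disp \<sigma> T w t" for w t
      define v where "v w = vel \<sigma> T w" for w
      define A where "A w t = \<sigma> * (delay_field a b g \<phi> (x w) (v w) t + l * f (t, x w t, v w t)) + c w" for w t
      let ?W = "periodic_ball T M"
      have W: "continuous_on UNIV w" "\<forall>t. w (t + T) = w t" "\<bar>w t\<bar> \<le> M" if "w \<in> ?W" for w t
        using that by (auto simp: periodic_ball_def)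
      have cw: "\<bar>c w\<bar> \<le> \<epsilon>" for w using \<epsilon>(1) by (auto simp: c_def)
      have xu: "\<bar>x w t - (p + c w)\<bar> \<le> \<delta>" if "w \<in> ?W" for w t
        using abs_disp_le[OF T \<sigma> W[OF that], of t] TTM by (simp add: x_def)
      have vu: "\<bar>v w t\<bar> \<le> \<delta>" if "w \<in> ?W" for w t
        using abs_vel_le[OF T \<sigma> W[OF that], of t] TM by (simp add: v_def)
      have xder: "(x w has_real_derivative v w t) (at t)" if "w \<in> ?W" for w t
        unfolding x_def[abs_def] v_def by (auto intro!: derivative_eq_intros disp_deriv[OF T \<sigma> W(1)[OF that]])
      have vder: "(v w has_real_derivative \<sigma> * (w t - mean T w)) (at t)" if "w \<in> ?W" for w t
        unfolding v_def by (rule vel_deriv[OF T \<sigma> W(1)[OF that]])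
      have tube: "tube p (x w) (v w)" if "w \<in> ?W" for w
      proof -
        have "continuous_on UNIV (x w)" "continuous_on UNIV (v w)"
          unfolding x_def[abs_def] v_def
          by (intro continuous_intros continuous_disp[OF T \<sigma>] continuous_vel[OF T \<sigma>] W(1)[OF that])+
        moreover have "\<bar>x w t - p\<bar> \<le> 2 \<and> \<bar>v w t\<bar> \<le> 1" for t
          using xu[OF that, of t] vu[OF that, of t] cw[of w] \<epsilon> \<delta> by linarith
        ultimately show ?thesis by (simp add: tube_def)
      qed
      note box = tube_box[OF tube]
      have xper: "x w (t + T) = x w t" if "w \<in> ?W" for w t
        using disp_periodic[OF T \<sigma> W(1,2)[OF that]] by (simp add: x_def)
      have vper: "v w (t + T) = v w t" if "w \<in> ?W" for w t
        using vel_periodic[OF T \<sigma> W(1,2)[OF that]] by (simp add: v_def)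
      obtain w where w: "w \<in> ?W" and fix_w: "\<And>t. A w t = w t"
      proof (rule schauder_periodic[OF T M])
        fix w t assume w: "w \<in> ?W"
        have "delay a b (\<lambda>s. \<phi> (x w s, v w s)) (t + T) = delay a b (\<lambda>s. \<phi> (x w s, v w s)) t"
          unfolding delay_def using xper[OF w, of "t - r" for r] vper[OF w, of "t - r" for r]
          by (intro Bochner_Integration.integral_cong refl) (simp add: algebra_simps)
        then show "A w (t + T) = A w t"
          using xper[OF w] vper[OF w] fper by (simp add: A_def delay_field_def)
        have "\<bar>delay_field a b g \<phi> (x w) (v w) t\<bar> \<le> M0" "\<bar>l * f (t, x w t, v w t)\<bar> \<le> min \<eta> 1"
          using M0(2)[OF tube[OF w]] lf box[OF w] by auto
        then show "\<bar>A w t\<bar> \<le> M" using \<sigma> cw[of w] \<epsilon> unfolding A_def M_def by auto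
      next
        fix e :: real assume e: "e > 0"
        obtain d1 where d1: "d1 > 0" and dd1: "\<And>x v x' v' t t'. \<lbrakk>tube p x v; tube p x' v';
            \<And>r. \<bar>x (t - r) - x' (t' - r)\<bar> \<le> d1; \<And>r. \<bar>v (t - r) - v' (t' - r)\<bar> \<le> d1\<rbrakk>
            \<Longrightarrow> \<bar>delay_field a b g \<phi> x v t - delay_field a b g \<phi> x' v' t'\<bar> \<le> e / 3"
          using delay_field_modulus[OF a g \<phi>, of "e / 3" p b] e by (metis divide_pos_pos zero_less_numeral)
        have el: "e / (3 * l) > 0" using e l by simp
        obtain d2 where d2: "d2 > 0" and dd2: "\<And>t t' y y' z z'. \<lbrakk>t \<in> {-T..2*T}; t' \<in> {-T..2*T};
            y \<in> {p-2..p+2}; y' \<in> {p-2..p+2}; z \<in> {-1..1}; z' \<in> {-1..1};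
            \<bar>t - t'\<bar> \<le> d2; \<bar>y - y'\<bar> \<le> d2; \<bar>z - z'\<bar> \<le> d2\<rbrakk> \<Longrightarrow> \<bar>f (t, y, z) - f (t', y', z')\<bar> \<le> e / (3 * l)"
          using modulus_of_continuity_3[OF f compact_Icc[of "-T" "2*T"] compact_Icc[of "p-2" "p+2"]
            compact_Icc[of "-1" 1] el] by blast
        \<comment> \<open>The positions differ by at most \<open>6 * d'\<close>: one part from time,
          one from \<open>c\<close> and four from \<open>disp\<close>. The velocities differ by at
          most \<open>(2 * M + 4) * d'\<close>. The bound \<open>e / 3\<close> is for the term
          \<open>c\<close> itself.\<close>
        define d' where "d' = min (e / 3) (min d1 d2 / (6 + 2 * M))"
        have "d' > 0" using e d1 d2 M by (simp add: d'_def)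
        moreover have "d' \<le> e / 3" unfolding d'_def by (rule min.cobounded1)
        ultimately have pos: "d' > 0" "d' \<le> e / 3" .
        have "d' \<le> min d1 d2 / (6 + 2 * M)" unfolding d'_def by (rule min.cobounded2)
        then have "d' * (6 + 2 * M) \<le> min d1 d2" using M by (subst (asm) pos_le_divide_eq) auto
        then have d'': "6 * d' + 2 * M * d' \<le> min d1 d2" by (simp add: algebra_simps)
        have Md': "0 < M * d'" using M pos by simp
        show "\<exists>d>0. \<forall>w \<in> ?W. \<forall>w' \<in> ?W. (\<forall>s. \<bar>w s - w' s\<bar> \<le> d) \<longrightarrow>
          (\<forall>t\<in>{-T..2*T}. \<forall>t'\<in>{-T..2*T}. \<bar>t - t'\<bar> \<le> d \<longrightarrow> \<bar>A w t - A w' t'\<bar> \<le> e)"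
        proof (intro exI[of _ d'] conjI ballI allI impI pos)
          fix w w' t t' assume w: "w \<in> ?W" "w' \<in> ?W" and ww: "\<forall>s. \<bar>w s - w' s\<bar> \<le> d'"
            and t: "t \<in> {-T..2*T}" "t' \<in> {-T..2*T}" "\<bar>t - t'\<bar> \<le> d'"
          note cont = W(1)[OF w(1)] W(1)[OF w(2)]
          have diff: "continuous_on UNIV (\<lambda>t. w t - w' t)" "\<forall>t. w (t + T) - w' (t + T) = w t - w' t"
            "\<And>t. \<bar>w t - w' t\<bar> \<le> d'"
            using cont W(2)[OF w(1)] W(2)[OF w(2)] ww by (auto intro!: continuous_intros)
          have cc: "\<bar>c w - c w'\<bar> \<le> d'"
            using abs_mean_le[OF T diff(1,3)] mean_diff[OF T cont] unfolding c_def by linarith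
          have T4: "4 * T * d' \<le> 4 * d'" using T1 pos by simp
          have "T * (4 * T * d') \<le> 1 * (4 * T * d')" using T1 T pos by (intro mult_right_mono) auto
          then have TT4: "4 * T * T * d' \<le> 4 * d'" using T4 by (simp add: algebra_simps)
          have xlip: "\<bar>x w s - x w s'\<bar> \<le> 1 * \<bar>s - s'\<bar>" for s s'
            using tube[OF w(1)] by (intro real_derivative_lipschitz[OF xder[OF w(1)]]) (auto simp: tube_def)
          have vlip: "\<bar>v w s - v w s'\<bar> \<le> 2 * M * \<bar>s - s'\<bar>" for s s'
          proof (rule real_derivative_lipschitz[OF vder[OF w(1)]])
            fix t show "\<bar>\<sigma> * (w t - mean T w)\<bar> \<le> 2 * M"
              using W(3)[OF w(1), of t] abs_mean_le[OF T cont(1) W(3)[OF w(1)]] \<sigma> by auto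
          qed
          have close: "\<bar>x w (t - r) - x w' (t' - r)\<bar> \<le> min d1 d2" "\<bar>v w (t - r) - v w' (t' - r)\<bar> \<le> min d1 d2" for r
          proof -
            have "\<bar>x w (t - r) - x w (t' - r)\<bar> \<le> d'" using xlip[of "t - r" "t' - r"] t(3) by simp
            moreover have "\<bar>disp \<sigma> T w (t' - r) - disp \<sigma> T w' (t' - r)\<bar> \<le> 4 * d'"
              using abs_disp_le[OF T \<sigma> diff, of "t' - r"] disp_diff[OF T \<sigma> cont, of "t' - r"] TT4 by simp
            ultimately have "\<bar>x w (t - r) - x w' (t' - r)\<bar> \<le> 6 * d'"
              using cc unfolding x_def by linarith
            then show "\<bar>x w (t - r) - x w' (t' - r)\<bar> \<le> min d1 d2" using d'' Md' by linarith
            have "2 * M * \<bar>t - t'\<bar> \<le> 2 * M * d'" using M t(3) by (intro mult_left_mono) auto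
            then have "\<bar>v w (t - r) - v w (t' - r)\<bar> \<le> 2 * M * d'" using vlip[of "t - r" "t' - r"] by simp
            moreover have "\<bar>v w (t' - r) - v w' (t' - r)\<bar> \<le> 4 * d'"
              using abs_vel_le[OF T \<sigma> diff, of "t' - r"] vel_diff[OF T \<sigma> cont, of "t' - r"] T4 by (simp add: v_def)
            ultimately show "\<bar>v w (t - r) - v w' (t' - r)\<bar> \<le> min d1 d2" using d'' pos by linarith
          qed
          have "\<bar>delay_field a b g \<phi> (x w) (v w) t - delay_field a b g \<phi> (x w') (v w') t'\<bar> \<le> e / 3"
            using close by (intro dd1 tube w) auto
          moreover have "\<bar>l * f (t, x w t, v w t) - l * f (t', x w' t', v w' t')\<bar> \<le> e / 3"
          proof -
            have "\<bar>t - t'\<bar> \<le> d2" using t(3) d'' pos Md' by linarith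
            then have "\<bar>f (t, x w t, v w t) - f (t', x w' t', v w' t')\<bar> \<le> e / (3 * l)"
              using close(1)[of 0] close(2)[of 0] t box[OF w(1)] box[OF w(2)] by (intro dd2) auto
            then have "l * \<bar>f (t, x w t, v w t) - f (t', x w' t', v w' t')\<bar> \<le> l * (e / (3 * l))"
              using l by (intro mult_left_mono) auto
            then show ?thesis using l by (simp add: abs_mult flip: right_diff_distrib)
          qed
          moreover have "A w t - A w' t' = \<sigma> * ((delay_field a b g \<phi> (x w) (v w) t - delay_field a b g \<phi> (x w') (v w') t')
            + (l * f (t, x w t, v w t) - l * f (t', x w' t', v w' t'))) + (c w - c w')"
            by (simp add: A_def algebra_simps)
          moreover have "\<bar>\<sigma> * (X + Y) + Z\<bar> \<le> e" if "\<bar>X\<bar> \<le> e / 3" "\<bar>Y\<bar> \<le> e / 3" "\<bar>Z\<bar> \<le> e / 3"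
            for X Y Z :: real using \<sigma> that by auto
          ultimately show "\<bar>A w t - A w' t'\<bar> \<le> e" using order_trans[OF cc pos(2)] by presburger
        qed
      next
        fix w assume "w \<in> ?W" "\<And>t. A w t = w t"
        then show thesis by (rule that)
      qed
      obtain z where z: "mean T w = w z" using mean_attained[OF T W(1)[OF w]] by blast
      \<comment> \<open>The whole history of the fixed point is within \<open>d\<close> of the
        constant state \<open>u\<close> at rest, where the field is \<open>\<Phi> u\<close>.\<close>
      have near: "\<bar>delay_field a b g \<phi> (x w) (v w) t - \<Phi> u\<bar> \<le> \<eta>" if "p + c w = u" for t u
      proof -
        have "tube p (\<lambda>_. u) (\<lambda>_. 0)" using that cw[of w] \<epsilon> by (auto simp: tube_def)
        then have "\<bar>delay_field a b g \<phi> (x w) (v w) t - delay_field a b g \<phi> (\<lambda>_. u) (\<lambda>_. 0) t\<bar> \<le> \<eta>"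
          using xu[OF w] vu[OF w] that \<delta>(2) by (intro dd tube w) (auto intro: order_trans)
        then show ?thesis by (simp add: field_const)
      qed
      have Az: "\<bar>w z - c w - \<sigma> * \<Phi> u\<bar> \<le> 2 * \<eta>" if "p + c w = u" for u
      proof -
        have "\<bar>l * f (z, x w z, v w z)\<bar> \<le> \<eta>" using lf[of "x w z" "v w z" z] box[OF w, of z] by linarith
        then have "\<bar>delay_field a b g \<phi> (x w) (v w) z + l * f (z, x w z, v w z) - \<Phi> u\<bar> \<le> 2 * \<eta>"
          using near[OF that, of z] by linarith
        moreover have "w z - c w - \<sigma> * \<Phi> u
            = \<sigma> * (delay_field a b g \<phi> (x w) (v w) z + l * f (z, x w z, v w z) - \<Phi> u)"
          using fix_w[of z, symmetric] by (simp add: A_def algebra_simps)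
        moreover have "\<bar>\<sigma> * r\<bar> = \<bar>r\<bar>" for r using \<sigma> by auto
        ultimately show ?thesis by presburger
      qed
      have c_mean: "c w = mean T w"
      proof -
        \<comment> \<open>If the truncation were active at \<open>\<epsilon>\<close>, the equation
          at \<open>z\<close> would give \<open>w z\<close> at most
          \<open>\<epsilon> - \<eta>\<close>, although \<open>w z\<close> is the mean. The other end
          is symmetric.\<close>
        have "\<not> mean T w > \<epsilon>"
        proof
          assume *: "mean T w > \<epsilon>"
          then have c: "c w = \<epsilon>" using \<epsilon> by (simp add: c_def)
          show False using Az[of "p + \<epsilon>"] \<eta> * z c by linarith
        qed
        moreover have "\<not> mean T w < - \<epsilon>"
        proof
          assume *: "mean T w < - \<epsilon>"
          then have c: "c w = - \<epsilon>" using \<epsilon> by (simp add: c_def)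
          show False using Az[of "p - \<epsilon>"] \<eta> * z c by linarith
        qed
        ultimately show ?thesis by (auto simp: c_def)
      qed
      have "periodic_solution a b g \<phi> l f T (x w)"
        unfolding periodic_solution_def
      proof (intro conjI exI allI)
        fix t
        show "x w (t + T) = x w t" by (rule xper[OF w])
        show "(x w has_real_derivative v w t) (at t)" by (rule xder[OF w])
        show "(v w has_real_derivative (\<lambda>t. \<sigma> * (w t - mean T w)) t) (at t)" using vder[OF w] by simp
        show "continuous_on UNIV (\<lambda>t. \<sigma> * (w t - mean T w))" using W(1)[OF w] by (intro continuous_intros)
        \<comment> \<open>With \<open>c w\<close> equal to the mean, multiply the fixed-point
          equation by \<open>\<sigma>\<close>, whose square is 1.\<close>
        have "\<sigma> * (w t - mean T w) = delay_field a b g \<phi> (x w) (v w) t + l * f (t, x w t, v w t)"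
          using fix_w[of t, symmetric] c_mean \<sigma> by (auto simp: A_def)
        then show "\<sigma> * (w t - mean T w) =
            g (x w t, v w t, LINT s:{..t}|lborel. gamma_density a b (t - s) * \<phi> (x w s, v w s))
            + l * f (t, x w t, v w t)"
          by (simp add: delay_field_def delay_eq_integral[OF a tube_compose_continuous[OF a g \<phi> tube[OF w]]])
      qed
      moreover have "\<bar>x w t - p\<bar> < e0" for t using xu[OF w, of t] cw[of w] \<delta> \<epsilon> by linarith
      ultimately show ?thesis by blast
    qed
    moreover have "l0 > 0" using \<eta> F by (simp add: l0_def)
    ultimately show "\<exists>l0>0. \<forall>l. 0 < l \<and> l < l0 \<longrightarrow> (\<exists>x. periodic_solution a b g \<phi> l f T x \<and> (\<forall>t. \<bar>x t - p\<bar> < e0))"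
      by blast
  qed
qed

section \<open>From a single zero to finitely many\<close>

theorem corollary6p3:
  fixes a :: real and b n :: nat
    and g :: "real \<times> real \<times> real \<Rightarrow> real" and \<phi> :: "real \<times> real \<Rightarrow> real"
    and I :: "real set" and p :: "nat \<Rightarrow> real"
  assumes "a > 0" and "b \<noteq> 0"
    and "locally_lipschitz g" and "locally_lipschitz \<phi>"
    and "open I" and "is_interval I"
    and "inj_on p {1..n}" and "p ` {1..n} \<subseteq> I"
    and "\<And>i. i \<in> {1..n} \<Longrightarrow> changes_sign_at_isolated_zero (\<lambda>u. g (u, 0, \<phi> (u, 0))) (p i)"
  shows "\<exists>T0>0. \<forall>T\<in>{0<..<T0}. \<forall>f :: real \<times> real \<times> real \<Rightarrow> real.
    continuous_on UNIV f \<longrightarrow> (\<forall>t u v. f (t + T, u, v) = f (t, u, v)) \<longrightarrow>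
    (\<exists>l0>0. \<forall>l\<in>{0<..<l0}. \<exists>x :: nat \<Rightarrow> real \<Rightarrow> real.
      (\<forall>i\<in>{1..n}. periodic_solution a b g \<phi> l f T (x i)) \<and>
      disjoint_family_on (\<lambda>i. range (x i)) {1..n})"
proof -
  let ?J = "{1..n}"
  \<comment> \<open>At most half the least distance between two zeros; the entry 1 keeps the minimum
    defined when there are no pairs.\<close>
  define e0 where "e0 = Min (insert 1 ((\<lambda>(i, j). \<bar>p i - p j\<bar> / 2) ` {(i, j) \<in> ?J \<times> ?J. i \<noteq> j}))"
  have fin: "finite {(i, j) \<in> ?J \<times> ?J. i \<noteq> j}" by (rule finite_subset[of _ "?J \<times> ?J"]) auto
  have e0: "e0 > 0"
    using assms(7) unfolding e0_def by (subst Min_gr_iff) (use fin in \<open>auto dest: inj_onD\<close>)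
  have sep: "2 * e0 \<le> \<bar>p i - p j\<bar>" if "i \<in> ?J" "j \<in> ?J" "i \<noteq> j" for i j
  proof -
    have "e0 \<le> \<bar>p i - p j\<bar> / 2" unfolding e0_def by (rule Min_le) (use that fin in \<open>auto\<close>)
    then show ?thesis by simp
  qed
  note cont = assms(3,4)[THEN locally_lipschitz_imp_continuous]
  have "\<exists>T0>0. \<forall>T (f :: real \<times> real \<times> real \<Rightarrow> real). 0 < T \<and> T < T0 \<and> continuous_on UNIV f \<and> (\<forall>t u v. f (t + T, u, v) = f (t, u, v)) \<longrightarrow>
      (\<exists>l0>0. \<forall>l. 0 < l \<and> l < l0 \<longrightarrow> (\<exists>x. periodic_solution a b g \<phi> l f T x \<and> (\<forall>t. \<bar>x t - p i\<bar> < e0)))"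
    if "i \<in> ?J" for i
    using periodic_solution_near_zero[OF assms(1) cont assms(9)[OF that] e0, of b] by metis
  then obtain T0 where T0: "\<And>i. i \<in> ?J \<Longrightarrow> T0 i > 0"
    and sol: "\<And>i T (f :: real \<times> real \<times> real \<Rightarrow> real). \<lbrakk>i \<in> ?J; 0 < T; T < T0 i; continuous_on UNIV f; \<forall>t u v. f (t + T, u, v) = f (t, u, v)\<rbrakk> \<Longrightarrow>
      \<exists>l0>0. \<forall>l. 0 < l \<and> l < l0 \<longrightarrow> (\<exists>x. periodic_solution a b g \<phi> l f T x \<and> (\<forall>t. \<bar>x t - p i\<bar> < e0))"
    by metis
  show ?thesis
  \<comment> \<open>The least of finitely many thresholds serves all zeros at once; the entry 1
    covers \<open>n = 0\<close>.\<close>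
  proof (rule exI[of _ "Min (insert 1 (T0 ` ?J))"], intro conjI ballI allI impI)
    show "0 < Min (insert 1 (T0 ` ?J))" using T0 by (subst Min_gr_iff) auto
    fix T and f :: "real \<times> real \<times> real \<Rightarrow> real" assume T: "T \<in> {0<..<Min (insert 1 (T0 ` ?J))}"
      and f: "continuous_on UNIV f" "\<forall>t u v. f (t + T, u, v) = f (t, u, v)"
    have "T < T0 i" if "i \<in> ?J" for i using T that by auto
    then have "\<exists>l0>0. \<forall>l. 0 < l \<and> l < l0 \<longrightarrow> (\<exists>x. periodic_solution a b g \<phi> l f T x \<and> (\<forall>t. \<bar>x t - p i\<bar> < e0))"
      if "i \<in> ?J" for i using sol[OF that _ _ f] T that by auto
    then obtain l0 where l0: "\<And>i. i \<in> ?J \<Longrightarrow> l0 i > 0"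
      and sol': "\<And>i l. \<lbrakk>i \<in> ?J; 0 < l; l < l0 i\<rbrakk> \<Longrightarrow>
        \<exists>x. periodic_solution a b g \<phi> l f T x \<and> (\<forall>t. \<bar>x t - p i\<bar> < e0)"
      by metis
    show "\<exists>l0>0. \<forall>l\<in>{0<..<l0}. \<exists>x :: nat \<Rightarrow> real \<Rightarrow> real.
      (\<forall>i\<in>?J. periodic_solution a b g \<phi> l f T (x i)) \<and> disjoint_family_on (\<lambda>i. range (x i)) ?J"
    proof (rule exI[of _ "Min (insert 1 (l0 ` ?J))"], intro conjI ballI)
      show "0 < Min (insert 1 (l0 ` ?J))" using l0 by (subst Min_gr_iff) auto
      fix l assume l: "l \<in> {0<..<Min (insert 1 (l0 ` ?J))}"
      have "\<exists>x. periodic_solution a b g \<phi> l f T x \<and> (\<forall>t. \<bar>x t - p i\<bar> < e0)" if "i \<in> ?J" for i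
        using sol'[OF that] l that by auto
      then obtain x where x: "\<And>i. i \<in> ?J \<Longrightarrow> periodic_solution a b g \<phi> l f T (x i)"
        and near: "\<And>i t. i \<in> ?J \<Longrightarrow> \<bar>x i t - p i\<bar> < e0" by metis
      have "range (x i) \<inter> range (x j) = {}" if "i \<in> ?J" "j \<in> ?J" "i \<noteq> j" for i j
      proof -
        have "x i s \<noteq> x j t" for s t
          using near[OF that(1), of s] near[OF that(2), of t] sep[OF that] by linarith
        then show ?thesis by auto
      qed
      then show "\<exists>x :: nat \<Rightarrow> real \<Rightarrow> real. (\<forall>i\<in>?J. periodic_solution a b g \<phi> l f T (x i)) \<and>
          disjoint_family_on (\<lambda>i. range (x i)) ?J"
        using x by (intro exI[of _ x]) (auto simp: disjoint_family_on_def)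
    qed
  qed
qed

end
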